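(* Let $(H,X)$ be a finite transitive permutation group. The infinite permutational wreath power $\ldots\wr H\wr H$ is topologically finitely generated (as a profinite group) if and only if the group $H$ is perfect.
   Context: All actions are faithful: a permutation group $(G,X)$ is a group $G$ acting faithfully on a set $X$; it is a finite transitive permutation group if $X$ is finite and nonempty and $G$ acts transitively on $X$. A group $H$ is perfect if it equals its commutator subgroup $H'$. For permutation groups $(G,X)$ and $(H,Y)$, the permutational wreath product $H\wr G$ is the semidirect product $H^{|X|}\rtimes G$ (one copy of $H$ for each element of $X$, with $G$ permuting the copies via its action on $X$), with its natural faithful action on $X\times Y$; equivalently, it is the group of all permutations of $X\times Y$ of the form $(x,y)\mapsto (g(x),h_x(y))$ with $g\in G$ and $h_x\in H$ for $x\in X$. This operation is associative, so $H\wr\ldots\wr H\wr H$ ($n$ factors) is a permutation group on $X^n$. The infinite wreath power $\ldots\wr H\wr H$ is the profinite group $\varprojlim_n\,(H\wr\ldots\wr H\wr H)$ ($n$ factors at stage $n$), where the connecting maps are the natural projections (the induced action on the first $n$ coordinates). A profinite group is topologically finitely generated if it contains a finitely generated dense subgroup. *)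

theory Defs
  imports "HOL-Analysis.Analysis" "HOL-Algebra.Group_Action" "HOL-Algebra.Generated_Groups"
    "HOL-Algebra.Product_Groups" "HOL-Library.NList"
begin

section \<open>Permutational wreath products\<close>

text \<open>A permutation group on \<open>X\<close> is given by a subgroup \<open>P\<close> of \<^term>\<open>BijGroup X\<close>; its elements
  are extensional, that is, \<^const>\<open>undefined\<close> outside \<open>X\<close>.\<close>

definition perm_group :: "('a \<Rightarrow> 'a) set \<Rightarrow> 'a set \<Rightarrow> ('a \<Rightarrow> 'a) monoid"
  where "perm_group P X = (BijGroup X)\<lparr>carrier := P\<rparr>"

definition perm_wreath ::
    "('b \<Rightarrow> 'b) set \<Rightarrow> 'b set \<Rightarrow> ('a \<Rightarrow> 'a) set \<Rightarrow> 'a set \<Rightarrow> ('a \<times> 'b \<Rightarrow> 'a \<times> 'b) set"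
  where "perm_wreath H Y G X =
    {\<lambda>(x, y)\<in>X \<times> Y. (g x, h x y) | g h. g \<in> G \<and> h \<in> X \<rightarrow> H}"

text \<open>\<open>X ^ n\<close> is the set of lists of length \<open>n\<close> over \<open>X\<close>, and \<open>X ^ n \<times> X\<close> is identified with
  \<open>X ^ (n + 1)\<close> by \<open>(xs, x) \<mapsto> xs @ [x]\<close>. The recursion starts with the empty product, the trivial
  group on the one-point set \<open>X ^ 0\<close>; the power with one factor is \<open>H\<close> itself, acting on lists of
  length one.\<close>

primrec wreath_power :: "('a \<Rightarrow> 'a) set \<Rightarrow> 'a set \<Rightarrow> nat \<Rightarrow> ('a list \<Rightarrow> 'a list) set"
  where
    "wreath_power H X 0 = {\<lambda>xs\<in>nlists 0 X. xs}"
  | "wreath_power H X (Suc n) =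
      (\<lambda>w. \<lambda>zs\<in>nlists (Suc n) X. case w (butlast zs, last zs) of (xs, x) \<Rightarrow> xs @ [x]) `
        perm_wreath H X (wreath_power H X n) (nlists n X)"

text \<open>The induced action on the first \<open>n\<close> coordinates does not depend on the letter that is appended
  (see \<open>butlast_wreath_power\<close> below).\<close>

definition wreath_proj ::
    "'a set \<Rightarrow> nat \<Rightarrow> ('a list \<Rightarrow> 'a list) \<Rightarrow> ('a list \<Rightarrow> 'a list)"
  where "wreath_proj X n f = (\<lambda>xs\<in>nlists n X. butlast (f (xs @ [SOME x. x \<in> X])))"


section \<open>Inverse limits of sequences of finite groups\<close>

definition inverse_limit ::
    "(nat \<Rightarrow> ('a, 'm) monoid_scheme) \<Rightarrow> (nat \<Rightarrow> 'a \<Rightarrow> 'a) \<Rightarrow> (nat \<Rightarrow> 'a) monoid"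
  where "inverse_limit G \<pi> = (product_group UNIV G)
    \<lparr>carrier := {s \<in> carrier (product_group UNIV G). \<forall>n. \<pi> n (s (Suc n)) = s n}\<rparr>"

definition inverse_limit_topology ::
    "(nat \<Rightarrow> ('a, 'm) monoid_scheme) \<Rightarrow> (nat \<Rightarrow> 'a \<Rightarrow> 'a) \<Rightarrow> (nat \<Rightarrow> 'a) topology"
  where "inverse_limit_topology G \<pi> =
    subtopology (product_topology (\<lambda>n. discrete_topology (carrier (G n))) UNIV)
      (carrier (inverse_limit G \<pi>))"

definition topologically_finitely_generated :: "('a, 'm) monoid_scheme \<Rightarrow> 'a topology \<Rightarrow> bool"
  where "topologically_finitely_generated G T \<longleftrightarrow>
    (\<exists>S. finite S \<and> S \<subseteq> carrier G \<and> Abstract_Topology.closure_of T (generate G S) = topspace T)"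

definition infinite_wreath_power ::
    "('a \<Rightarrow> 'a) set \<Rightarrow> 'a set \<Rightarrow> (nat \<Rightarrow> 'a list \<Rightarrow> 'a list) monoid"
  where "infinite_wreath_power H X =
    inverse_limit (\<lambda>n. perm_group (wreath_power H X n) (nlists n X)) (wreath_proj X)"

definition infinite_wreath_power_topology ::
    "('a \<Rightarrow> 'a) set \<Rightarrow> 'a set \<Rightarrow> (nat \<Rightarrow> 'a list \<Rightarrow> 'a list) topology"
  where "infinite_wreath_power_topology H X =
    inverse_limit_topology (\<lambda>n. perm_group (wreath_power H X n) (nlists n X)) (wreath_proj X)"

definition perfect_group :: "('a, 'm) monoid_scheme \<Rightarrow> bool"
  where "perfect_group G \<longleftrightarrow> group G \<and> derived G (carrier G) = carrier G"


section \<open>Basic properties\<close>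

text \<open>These default rules make the simplifier loop on goals about lengths and sets of lists.\<close>

declare nlistsE_length [simp del] nlistsE_set [simp del] nlists_appendE [rule del]
  nlists_Cons_Suc [rule del] nlists_update_in_list [simp del, rule del]

lemma nlists_snoc_iff: "xs @ [x] \<in> nlists (Suc n) X \<longleftrightarrow> xs \<in> nlists n X \<and> x \<in> X"
  by (auto simp: nlists_def)

lemma nlists_Suc_snocE:
  assumes "zs \<in> nlists (Suc n) X"
  obtains xs x where "zs = xs @ [x]" "xs \<in> nlists n X" "x \<in> X"
  using assms by (cases zs rule: rev_cases) (auto simp: nlists_def)

lemma wreath_power_Suc_iff:
  "f \<in> wreath_power H X (Suc n) \<longleftrightarrow> f \<in> extensional (nlists (Suc n) X) \<and>
    (\<exists>g\<in>wreath_power H X n. \<exists>h\<in>nlists n X \<rightarrow> H. \<forall>xs\<in>nlists n X. \<forall>x\<in>X. f (xs @ [x]) = g xs @ [h xs x])"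
    (is "?L \<longleftrightarrow> ?R")
proof
  assume ?L
  then obtain g h where g: "g \<in> wreath_power H X n" and h: "h \<in> nlists n X \<rightarrow> H" and
    f: "f = (\<lambda>zs\<in>nlists (Suc n) X. case (\<lambda>(x, y)\<in>nlists n X \<times> X. (g x, h x y)) (butlast zs, last zs)
              of (xs, x) \<Rightarrow> xs @ [x])"
    by (auto simp: perm_wreath_def)
  have "\<forall>xs\<in>nlists n X. \<forall>x\<in>X. f (xs @ [x]) = g xs @ [h xs x]"
    by (simp add: f nlists_snoc_iff)
  with g h show ?R by (auto simp: f)
next
  assume ?R
  then obtain g h where g: "g \<in> wreath_power H X n" and h: "h \<in> nlists n X \<rightarrow> H" and
    e: "f \<in> extensional (nlists (Suc n) X)" and
    f: "\<And>xs x. xs \<in> nlists n X \<Longrightarrow> x \<in> X \<Longrightarrow> f (xs @ [x]) = g xs @ [h xs x]"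
    by blast
  have "f = (\<lambda>zs\<in>nlists (Suc n) X. case (\<lambda>(x, y)\<in>nlists n X \<times> X. (g x, h x y)) (butlast zs, last zs)
              of (xs, x) \<Rightarrow> xs @ [x])" (is "_ = ?F")
  proof (rule extensionalityI[OF e])
    fix zs assume "zs \<in> nlists (Suc n) X"
    then show "f zs = ?F zs"
      by (elim nlists_Suc_snocE) (simp add: f nlists_snoc_iff)
  qed simp
  with g h show ?L unfolding wreath_power.simps perm_wreath_def by blast
qed

lemma wreath_power_SucE:
  assumes "f \<in> wreath_power H X (Suc n)"
  obtains g h where "g \<in> wreath_power H X n" "h \<in> nlists n X \<rightarrow> H"
    "\<And>xs x. xs \<in> nlists n X \<Longrightarrow> x \<in> X \<Longrightarrow> f (xs @ [x]) = g xs @ [h xs x]"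
  using assms unfolding wreath_power_Suc_iff by blast

lemma wreath_power_extensional: "f \<in> wreath_power H X n \<Longrightarrow> f \<in> extensional (nlists n X)"
  by (cases n) (auto simp: wreath_power_Suc_iff simp del: wreath_power.simps(2))

lemma wreath_proj_eq:
  assumes "X \<noteq> {}" "g \<in> wreath_power H X n"
    "\<And>xs x. xs \<in> nlists n X \<Longrightarrow> x \<in> X \<Longrightarrow> f (xs @ [x]) = g xs @ [h xs x]"
  shows "wreath_proj X n f = g"
  using assms wreath_power_extensional[OF assms(2)]
  by (intro extensionalityI[where A = "nlists n X"]) (auto simp: wreath_proj_def some_in_eq)

lemma wreath_proj_closed:
  assumes "X \<noteq> {}" "f \<in> wreath_power H X (Suc n)"
  shows "wreath_proj X n f \<in> wreath_power H X n"
  using assms(2) by (elim wreath_power_SucE) (simp add: wreath_proj_eq[OF assms(1)])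

lemma butlast_wreath_power:
  assumes "X \<noteq> {}" "f \<in> wreath_power H X (Suc n)" "zs \<in> nlists (Suc n) X"
  shows "butlast (f zs) = wreath_proj X n f (butlast zs)"
  using assms(2,3)
  by (elim wreath_power_SucE nlists_Suc_snocE) (simp add: wreath_proj_eq[OF assms(1)])

lemma wreath_power_Bij:
  assumes "H \<subseteq> Bij X"
  shows "wreath_power H X n \<subseteq> Bij (nlists n X)"
proof (induction n)
  case 0
  then show ?case using id_Bij by auto
next
  case (Suc n)
  show ?case
  proof
    fix f assume f: "f \<in> wreath_power H X (Suc n)"
    then obtain g h where g: "g \<in> wreath_power H X n" and h: "h \<in> nlists n X \<rightarrow> H" and
      fgh: "\<And>xs x. xs \<in> nlists n X \<Longrightarrow> x \<in> X \<Longrightarrow> f (xs @ [x]) = g xs @ [h xs x]"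
      by (elim wreath_power_SucE) blast
    have gB: "bij_betw g (nlists n X) (nlists n X)"
      using Suc g by (auto simp: Bij_def)
    have hB: "bij_betw (h xs) X X" if "xs \<in> nlists n X" for xs
      using assms h that by (auto simp: Bij_def Pi_iff)
    have "inj_on f (nlists (Suc n) X)"
    proof (rule inj_onI)
      fix zs ws assume *: "zs \<in> nlists (Suc n) X" "ws \<in> nlists (Suc n) X" "f zs = f ws"
      then obtain xs x ys y where "zs = xs @ [x]" "xs \<in> nlists n X" "x \<in> X"
        "ws = ys @ [y]" "ys \<in> nlists n X" "y \<in> X"
        by (elim nlists_Suc_snocE) blast
      with * show "zs = ws"
        using gB hB by (auto simp: fgh bij_betw_def dest: inj_onD)
    qed
    moreover have "f ` nlists (Suc n) X = nlists (Suc n) X"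
    proof
      show "f ` nlists (Suc n) X \<subseteq> nlists (Suc n) X"
      proof
        fix w assume "w \<in> f ` nlists (Suc n) X"
        then obtain xs x where "w = f (xs @ [x])" "xs \<in> nlists n X" "x \<in> X"
          by (auto elim: nlists_Suc_snocE)
        then show "w \<in> nlists (Suc n) X"
          using bij_betwE[OF gB] bij_betwE[OF hB] by (simp add: fgh nlists_snoc_iff)
      qed
      show "nlists (Suc n) X \<subseteq> f ` nlists (Suc n) X"
      proof
        fix ws assume "ws \<in> nlists (Suc n) X"
        then obtain ys y where ys: "ws = ys @ [y]" "ys \<in> nlists n X" "y \<in> X"
          by (rule nlists_Suc_snocE)
        then obtain xs where xs: "xs \<in> nlists n X" "g xs = ys"
          using gB by (metis bij_betw_def imageE)
        then obtain x where x: "x \<in> X" "h xs x = y"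
          using hB ys(3) by (metis bij_betw_def imageE)
        have "ws = f (xs @ [x])" using xs x ys by (simp add: fgh)
        then show "ws \<in> f ` nlists (Suc n) X"
          using xs x by (auto simp: nlists_snoc_iff)
      qed
    qed
    ultimately show "f \<in> Bij (nlists (Suc n) X)"
      using wreath_power_extensional[OF f] by (auto simp: Bij_def bij_betw_def)
  qed
qed

lemma subgroup_BijGroupD:
  assumes "subgroup P (BijGroup X)"
  shows "P \<subseteq> Bij X" "(\<lambda>x\<in>X. x) \<in> P"
    "\<And>f g. f \<in> P \<Longrightarrow> g \<in> P \<Longrightarrow> compose X f g \<in> P"
    "\<And>f. f \<in> P \<Longrightarrow> restrict (inv_into X f) X \<in> P"
proof -
  show sub: "P \<subseteq> Bij X"
    using subgroup.subset[OF assms] by (simp add: BijGroup_def)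
  show "(\<lambda>x\<in>X. x) \<in> P"
    using subgroup.one_closed[OF assms] by (simp add: BijGroup_def)
  show "compose X f g \<in> P" if "f \<in> P" "g \<in> P" for f g
    using subgroup.m_closed[OF assms that] subsetD[OF sub that(1)] subsetD[OF sub that(2)]
    by (simp add: BijGroup_def)
  show "restrict (inv_into X f) X \<in> P" if "f \<in> P" for f
    using subgroup.m_inv_closed[OF assms that] subsetD[OF sub that] by (simp add: inv_BijGroup)
qed

lemma subgroup_wreath_power:
  assumes "subgroup H (BijGroup X)"
  shows "subgroup (wreath_power H X n) (BijGroup (nlists n X))"
proof (induction n)
  case 0
  show ?case
    using group.triv_subgroup[OF group_BijGroup, of "nlists 0 X"] by (simp add: BijGroup_def)
next
  case (Suc n)
  note H = subgroup_BijGroupD[OF assms] and W = subgroup_BijGroupD[OF Suc]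
  let ?S = "nlists (Suc n) X" and ?W = "wreath_power H X (Suc n)"
  have sub: "?W \<subseteq> Bij ?S" by (rule wreath_power_Bij[OF H(1)])
  show ?case
  proof (rule group.subgroupI[OF group_BijGroup])
    show "?W \<subseteq> carrier (BijGroup ?S)" using sub by (simp add: BijGroup_def)
    have "(\<lambda>zs\<in>?S. zs) \<in> ?W"
      unfolding wreath_power_Suc_iff
      by (intro conjI bexI[OF _ W(2)] bexI[of _ "\<lambda>_. \<lambda>x\<in>X. x"]) (auto simp: nlists_snoc_iff H(2))
    then show "?W \<noteq> {}" by blast
  next
    fix f assume f: "f \<in> ?W"
    then obtain g h where g: "g \<in> wreath_power H X n" and h: "h \<in> nlists n X \<rightarrow> H" and
      fgh: "\<And>xs x. xs \<in> nlists n X \<Longrightarrow> x \<in> X \<Longrightarrow> f (xs @ [x]) = g xs @ [h xs x]"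
      by (elim wreath_power_SucE) blast
    have gB: "bij_betw g (nlists n X) (nlists n X)" using W(1) g by (auto simp: Bij_def)
    have fB: "bij_betw f ?S ?S" using sub f by (auto simp: Bij_def)
    have hB: "bij_betw (h xs) X X" if "xs \<in> nlists n X" for xs
      using H(1) h that by (auto simp: Bij_def Pi_iff)
    let ?g = "restrict (inv_into (nlists n X) g) (nlists n X)"
    let ?h = "\<lambda>xs. restrict (inv_into X (h (?g xs))) X"
    have gin: "?g xs \<in> nlists n X" "g (?g xs) = xs" if "xs \<in> nlists n X" for xs
      using bij_betw_apply[OF bij_betw_inv_into[OF gB] that] bij_betw_inv_into_right[OF gB that] that
      by simp_all
    have "?h \<in> nlists n X \<rightarrow> H"
      by (intro funcsetI H(4) funcset_mem[OF h] gin(1))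
    moreover have "restrict (inv_into ?S f) ?S (xs @ [x]) = ?g xs @ [?h xs x]"
      if xs: "xs \<in> nlists n X" and x: "x \<in> X" for xs x
    proof -
      have hin: "?h xs x \<in> X" "h (?g xs) (?h xs x) = x"
        using bij_betw_apply[OF bij_betw_inv_into[OF hB[OF gin(1)[OF xs]]] x]
          bij_betw_inv_into_right[OF hB[OF gin(1)[OF xs]] x] x
        by simp_all
      have "f (?g xs @ [?h xs x]) = xs @ [x]"
        by (simp only: fgh[OF gin(1)[OF xs] hin(1)] gin(2)[OF xs] hin(2))
      moreover have "?g xs @ [?h xs x] \<in> ?S"
        using gin(1)[OF xs] hin(1) by (simp only: nlists_snoc_iff)
      ultimately have "inv_into ?S f (xs @ [x]) = ?g xs @ [?h xs x]"
        using bij_betw_inv_into_left[OF fB] by metis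
      moreover have "xs @ [x] \<in> ?S" using xs x by (simp only: nlists_snoc_iff)
      ultimately show ?thesis by (simp only: restrict_apply' simp_thms)
    qed
    ultimately have "restrict (inv_into ?S f) ?S \<in> ?W"
      unfolding wreath_power_Suc_iff
      by (intro conjI bexI[OF _ W(4)[OF g]] bexI[of _ ?h]) auto
    then show "inv\<^bsub>BijGroup ?S\<^esub> f \<in> ?W"
      by (simp only: inv_BijGroup[OF subsetD[OF sub f]])
  next
    fix f f' assume f: "f \<in> ?W" and f': "f' \<in> ?W"
    then obtain g h g' h' where g: "g \<in> wreath_power H X n" and h: "h \<in> nlists n X \<rightarrow> H" and
      fgh: "\<And>xs x. xs \<in> nlists n X \<Longrightarrow> x \<in> X \<Longrightarrow> f (xs @ [x]) = g xs @ [h xs x]" and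
      g': "g' \<in> wreath_power H X n" and h': "h' \<in> nlists n X \<rightarrow> H" and
      fgh': "\<And>xs x. xs \<in> nlists n X \<Longrightarrow> x \<in> X \<Longrightarrow> f' (xs @ [x]) = g' xs @ [h' xs x]"
      by (elim wreath_power_SucE) blast
    have g'in: "g' xs \<in> nlists n X" if "xs \<in> nlists n X" for xs
      using W(1) g' that Bij_imp_funcset by blast
    have h'in: "h' xs x \<in> X" if "xs \<in> nlists n X" "x \<in> X" for xs x
      using H(1) h' that Bij_imp_funcset by blast
    let ?h = "\<lambda>xs. compose X (h (g' xs)) (h' xs)"
    have "?h \<in> nlists n X \<rightarrow> H"
      by (intro funcsetI H(3) funcset_mem[OF h] funcset_mem[OF h'] g'in)
    moreover have "compose ?S f f' (xs @ [x]) = compose (nlists n X) g g' xs @ [?h xs x]"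
      if "xs \<in> nlists n X" "x \<in> X" for xs x
      using that by (simp add: compose_eq nlists_snoc_iff fgh' fgh g'in h'in)
    moreover have "compose ?S f f' \<in> extensional ?S" by simp
    ultimately have "compose ?S f f' \<in> ?W"
      unfolding wreath_power_Suc_iff
      by (intro conjI bexI[OF _ W(3)[OF g g']] bexI[of _ ?h]) auto
    then show "f \<otimes>\<^bsub>BijGroup ?S\<^esub> f' \<in> ?W"
      using subsetD[OF sub f] subsetD[OF sub f'] by (simp add: BijGroup_def del: wreath_power.simps)
  qed
qed

lemma group_wreath_power:
  "subgroup H (BijGroup X) \<Longrightarrow> group (perm_group (wreath_power H X n) (nlists n X))"
  unfolding perm_group_def
  by (rule group.subgroup_imp_group[OF group_BijGroup subgroup_wreath_power])

lemma wreath_proj_hom: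
  assumes H: "subgroup H (BijGroup X)" and X: "X \<noteq> {}"
  shows "wreath_proj X n \<in> hom (perm_group (wreath_power H X (Suc n)) (nlists (Suc n) X))
    (perm_group (wreath_power H X n) (nlists n X))"
proof (rule homI)
  fix f f' assume *: "f \<in> carrier (perm_group (wreath_power H X (Suc n)) (nlists (Suc n) X))"
    "f' \<in> carrier (perm_group (wreath_power H X (Suc n)) (nlists (Suc n) X))"
  then have f: "f \<in> wreath_power H X (Suc n)" "f' \<in> wreath_power H X (Suc n)"
    by (auto simp: perm_group_def)
  have B: "wreath_power H X m \<subseteq> Bij (nlists m X)" for m
    by (rule wreath_power_Bij[OF subgroup_BijGroupD(1)[OF H]])
  have p: "wreath_proj X n f \<in> wreath_power H X n" "wreath_proj X n f' \<in> wreath_power H X n"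
    using wreath_proj_closed[OF X] f by auto
  have "wreath_proj X n (compose (nlists (Suc n) X) f f') =
      compose (nlists n X) (wreath_proj X n f) (wreath_proj X n f')"
  proof (rule extensionalityI[where A = "nlists n X"])
    fix xs assume xs: "xs \<in> nlists n X"
    let ?zs = "xs @ [SOME x. x \<in> X]"
    have zs: "?zs \<in> nlists (Suc n) X" using X xs by (simp add: nlists_snoc_iff some_in_eq)
    moreover have "f' ?zs \<in> nlists (Suc n) X"
      using B f(2) zs Bij_imp_funcset by blast
    ultimately show "wreath_proj X n (compose (nlists (Suc n) X) f f') xs =
        compose (nlists n X) (wreath_proj X n f) (wreath_proj X n f') xs"
      using xs butlast_wreath_power[OF X f(1)] butlast_wreath_power[OF X f(2) zs]
      by (simp add: compose_eq) (simp add: wreath_proj_def compose_eq)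
  qed (simp_all add: wreath_proj_def)
  then show "wreath_proj X n (f \<otimes>\<^bsub>perm_group (wreath_power H X (Suc n)) (nlists (Suc n) X)\<^esub> f') =
      wreath_proj X n f \<otimes>\<^bsub>perm_group (wreath_power H X n) (nlists n X)\<^esub> wreath_proj X n f'"
    using B f p by (simp add: perm_group_def BijGroup_def subset_iff del: wreath_power.simps)
qed (use wreath_proj_closed[OF X] in \<open>auto simp: perm_group_def simp del: wreath_power.simps\<close>)

lemma group_inverse_limit:
  assumes G: "\<And>n. group (G n)" and \<pi>: "\<And>n. \<pi> n \<in> hom (G (Suc n)) (G n)"
  shows "group (inverse_limit G \<pi>)"
proof -
  interpret P: group "product_group UNIV G" using G by simp
  have "subgroup {s \<in> carrier (product_group UNIV G). \<forall>n. \<pi> n (s (Suc n)) = s n} (product_group UNIV G)"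
  proof (rule P.subgroupI)
    have "\<one>\<^bsub>product_group UNIV G\<^esub> \<in> {s \<in> carrier (product_group UNIV G). \<forall>n. \<pi> n (s (Suc n)) = s n}"
      using P.one_closed by (auto simp: hom_one[OF \<pi> G G])
    then show "{s \<in> carrier (product_group UNIV G). \<forall>n. \<pi> n (s (Suc n)) = s n} \<noteq> {}" by blast
  next
    fix s assume s: "s \<in> {s \<in> carrier (product_group UNIV G). \<forall>n. \<pi> n (s (Suc n)) = s n}"
    have "inv\<^bsub>product_group UNIV G\<^esub> s = (\<lambda>n. inv\<^bsub>G n\<^esub> s n)"
      using inv_product_group[of s UNIV G] s G by (simp add: restrict_def)
    moreover have "\<pi> n (inv\<^bsub>G (Suc n)\<^esub> s (Suc n)) = inv\<^bsub>G n\<^esub> s n" for n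
      using s group_hom.hom_inv[of "G (Suc n)" "G n" "\<pi> n" "s (Suc n)"] G \<pi>
      by (auto simp: group_hom_def group_hom_axioms_def PiE_iff)
    ultimately show "inv\<^bsub>product_group UNIV G\<^esub> s
        \<in> {s \<in> carrier (product_group UNIV G). \<forall>n. \<pi> n (s (Suc n)) = s n}"
      using s P.inv_closed[of s] by simp
  next
    fix s t assume s: "s \<in> {s \<in> carrier (product_group UNIV G). \<forall>n. \<pi> n (s (Suc n)) = s n}"
      and t: "t \<in> {s \<in> carrier (product_group UNIV G). \<forall>n. \<pi> n (s (Suc n)) = s n}"
    have "\<pi> n (s (Suc n) \<otimes>\<^bsub>G (Suc n)\<^esub> t (Suc n)) = s n \<otimes>\<^bsub>G n\<^esub> t n" for n
      using s t hom_mult[OF \<pi>, of "s (Suc n)" n "t (Suc n)"] by (simp add: PiE_iff)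
    then show "s \<otimes>\<^bsub>product_group UNIV G\<^esub> t
        \<in> {s \<in> carrier (product_group UNIV G). \<forall>n. \<pi> n (s (Suc n)) = s n}"
      using s t P.m_closed[of s t] by simp
  qed auto
  then show ?thesis unfolding inverse_limit_def by (rule P.subgroup_imp_group)
qed

lemma group_infinite_wreath_power:
  "subgroup H (BijGroup X) \<Longrightarrow> X \<noteq> {} \<Longrightarrow> group (infinite_wreath_power H X)"
  unfolding infinite_wreath_power_def
  by (intro group_inverse_limit group_wreath_power wreath_proj_hom)

lemma topspace_infinite_wreath_power_topology:
  "topspace (infinite_wreath_power_topology H X) = carrier (infinite_wreath_power H X)"
  by (auto simp: infinite_wreath_power_topology_def infinite_wreath_power_def
      inverse_limit_topology_def inverse_limit_def)

end

theory Submission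
  imports Defs "HOL-Algebra.FiniteProduct"
begin

text \<open>If \<open>H\<close> is not perfect, multiplying the classes in \<open>H / H'\<close> of all labels on one level gives
  for every level a homomorphism from the wreath power to the finite group \<open>H / H'\<close>. On a finite set
  of generators two of these homomorphisms agree, hence they agree on a dense subgroup and thus
  everywhere, but an element with a single label outside \<open>H'\<close> separates them.

  If \<open>H\<close> is perfect, take as generators the labels at the root and at one vertex \<open>a\<close> of level one,
  together with two kinds of elements whose equal labels sit at the vertices
  \<open>a\<^sup>e\<^sup>+\<^sup>2\<^sup>i b a\<close> for \<open>e = 0, 1\<close>. Once all labels above level \<open>n\<close> are available, the commutator of
  the part of such an element from level \<open>n\<close> on with a suitable conjugate has a single commutator of
  \<open>H\<close> at one vertex of level \<open>n\<close>. Perfectness then gives all of \<open>H\<close> at this vertex, and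
  transitivity all labels on level \<open>n\<close>.\<close>

section \<open>Tree automorphisms and their portraits\<close>

text \<open>A portrait \<open>p\<close> gives a permutation of the letters for every word; the automorphism it
  describes sends the letter \<open>x\<close> that follows the prefix \<open>xs\<close> to \<open>p xs x\<close>
  (see \<open>tree_map_snoc\<close>).\<close>

primrec tree_map :: "('a list \<Rightarrow> 'a \<Rightarrow> 'a) \<Rightarrow> 'a list \<Rightarrow> 'a list" where
  "tree_map p [] = []"
| "tree_map p (x # xs) = p [] x # tree_map (\<lambda>ys. p (x # ys)) xs"

lemma tree_map_append:
  "tree_map p (xs @ ys) = tree_map p xs @ tree_map (\<lambda>zs. p (xs @ zs)) ys"
  by (induction xs arbitrary: p) auto

lemma tree_map_snoc [simp]: "tree_map p (xs @ [x]) = tree_map p xs @ [p xs x]"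
  by (simp add: tree_map_append)

lemma length_tree_map [simp]: "length (tree_map p xs) = length xs"
  by (induction xs arbitrary: p) auto

text \<open>Only the labels at proper prefixes of a word are applied to it; the label at the word
  itself acts on the letter that would come next. This strictness is what lets portraits be changed
  level by level.\<close>

lemma tree_map_cong:
  assumes "\<And>ys x zs. xs = ys @ x # zs \<Longrightarrow> p ys = q ys"
  shows "tree_map p xs = tree_map q xs"
  using assms
proof (induction xs rule: rev_induct)
  case (snoc x xs)
  have "p xs = q xs" using snoc.prems[of xs x "[]"] by simp
  moreover have "tree_map p xs = tree_map q xs" using snoc by simp
  ultimately show ?case by simp
qed simp

lemma tree_map_id [simp]: "tree_map (\<lambda>_. id) = id"
proof
  show "tree_map (\<lambda>_. id) xs = id xs" for xs :: "'a list" by (induction xs) auto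
qed

lemma tree_map_fixed:
  assumes "\<And>ys x zs. xs = ys @ x # zs \<Longrightarrow> p ys = id"
  shows "tree_map p xs = xs"
  using tree_map_cong[of xs p "\<lambda>_. id"] assms by simp

text \<open>The cocycle rule: the label of \<open>p\<close> is read at the image of the prefix under
  \<open>tree_map q\<close>. It makes tree maps closed under composition.\<close>

lemma tree_map_comp:
  "tree_map p \<circ> tree_map q = tree_map (\<lambda>xs. p (tree_map q xs) \<circ> q xs)"
proof
  show "(tree_map p \<circ> tree_map q) xs = tree_map (\<lambda>xs. p (tree_map q xs) \<circ> q xs) xs" for xs
    by (induction xs rule: rev_induct) auto
qed

lemma bij_tree_map:
  assumes "\<And>xs. bij (p xs)"
  shows "bij (tree_map p)"
proof (rule bijI)
  show "inj (tree_map p)"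
  proof (rule injI)
    fix xs ys assume "tree_map p xs = tree_map p ys"
    then show "xs = ys"
    proof (induction xs arbitrary: ys rule: rev_induct)
      case Nil
      then show ?case by (metis length_0_conv length_tree_map)
    next
      case (snoc x xs)
      then obtain zs z where "ys = zs @ [z]"
        by (metis length_0_conv length_tree_map rev_exhaust snoc_eq_iff_butlast)
      then show ?case using snoc assms[of zs] by (auto simp: bij_def dest: injD)
    qed
  qed
  show "surj (tree_map p)"
  proof (rule surjI)
    fix xs
    show "tree_map p (SOME ys. tree_map p ys = xs) = xs"
    proof (rule someI_ex, induction xs rule: rev_induct)
      case Nil
      then show ?case using tree_map.simps(1) by blast
    next
      case (snoc x xs)
      then obtain ys where "tree_map p ys = xs" by blast
      then have "tree_map p (ys @ [inv_into UNIV (p ys) x]) = xs @ [x]"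
        using assms[of ys] by (simp add: bij_is_surj surj_f_inv_f)
      then show ?case by blast
    qed
  qed
qed

text \<open>Undoing the last letter takes the label at the preimage of its prefix, so the inverse is
  again given by a portrait, and its labels are inverses of labels of \<open>p\<close>.\<close>

lemma inv_tree_map:
  assumes "\<And>xs. bij (p xs)"
  shows "inv_into UNIV (tree_map p) = tree_map (\<lambda>xs. inv_into UNIV (p (inv_into UNIV (tree_map p) xs)))"
proof
  note bij_tree_map[of p, OF assms]
  fix xs
  show "inv_into UNIV (tree_map p) xs = tree_map (\<lambda>xs. inv_into UNIV (p (inv_into UNIV (tree_map p) xs))) xs"
  proof (induction xs rule: rev_induct)
    case Nil
    have "tree_map p [] = []" by simp
    then show ?case using \<open>bij (tree_map p)\<close> by (metis bij_inv_eq_iff tree_map.simps(1))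
  next
    case (snoc x xs)
    let ?ys = "inv_into UNIV (tree_map p) xs"
    have "tree_map p (?ys @ [inv_into UNIV (p ?ys) x]) = xs @ [x]"
      using assms[of ?ys] \<open>bij (tree_map p)\<close> by (simp add: bij_is_surj surj_f_inv_f)
    then have "inv_into UNIV (tree_map p) (xs @ [x]) = ?ys @ [inv_into UNIV (p ?ys) x]"
      using \<open>bij (tree_map p)\<close> by (metis bij_inv_eq_iff)
    then show ?case using snoc by simp
  qed
qed

text \<open>Level \<open>n\<close> may carry labels of both: proper prefixes of words of length at
  most \<open>n\<close> carry no label of \<open>q\<close>, so \<open>tree_map q\<close> fixes every
  vertex where \<open>p\<close> is nontrivial and the shift in the cocycle rule disappears.\<close>

lemma tree_map_comp_levels:
  assumes "\<And>xs. p xs \<noteq> id \<Longrightarrow> length xs \<le> n" "\<And>xs. q xs \<noteq> id \<Longrightarrow> n \<le> length xs"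
  shows "tree_map p \<circ> tree_map q = tree_map (\<lambda>xs. p xs \<circ> q xs)"
proof -
  have "p (tree_map q xs) = p xs" for xs
  proof (cases "length xs \<le> n")
    case True
    then have "tree_map q xs = xs"
      using assms(2) by (intro tree_map_fixed) fastforce
    then show ?thesis by simp
  next
    case False
    then show ?thesis using assms(1) by (metis length_tree_map)
  qed
  then show ?thesis by (simp add: tree_map_comp)
qed

section \<open>Tree maps with one label\<close>

definition single :: "'a list \<Rightarrow> ('a \<Rightarrow> 'a) \<Rightarrow> 'a list \<Rightarrow> 'a \<Rightarrow> 'a" where
  "single v k = (\<lambda>xs. if xs = v then k else id)"

lemma single_same [simp]: "single v k v = k"
  and single_other [simp]: "xs \<noteq> v \<Longrightarrow> single v k xs = id"
  by (simp_all add: single_def)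

lemma single_id [simp]: "single v id = (\<lambda>_. id)"
  by (auto simp: single_def)

lemma tree_map_single_comp:
  "tree_map (single v k) \<circ> tree_map (single v l) = tree_map (single v (k \<circ> l))"
proof -
  have "(\<lambda>xs. single v k xs \<circ> single v l xs) = single v (k \<circ> l)"
    by (auto simp: single_def)
  then show ?thesis
    using tree_map_comp_levels[of "single v k" "length v" "single v l"]
    by (metis le_refl single_other)
qed

lemma tree_map_single_moves:
  assumes "tree_map (single v k) xs \<noteq> xs"
  shows "\<exists>x ys. xs = v @ x # ys"
proof (rule ccontr)
  assume "\<nexists>x ys. xs = v @ x # ys"
  then have "tree_map (single v k) xs = xs" by (intro tree_map_fixed single_other) auto
  with assms show False by simp
qed

lemma tree_map_single_below: "tree_map (single v k) (v @ x # ys) = v @ k x # ys"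
proof -
  have "tree_map (single v k) v = v" by (intro tree_map_fixed single_other) auto
  moreover have "(\<lambda>zs. single v k (v @ x # zs)) = (\<lambda>_. id)" by auto
  ultimately show ?thesis by (simp add: tree_map_append)
qed

text \<open>All labels of \<open>q\<close> lie strictly above the level of \<open>v\<close>, so
  \<open>tree_map q\<close> changes only earlier letters. Conjugation carries the label to another
  vertex without altering \<open>k\<close>.\<close>

lemma tree_map_conj_single:
  assumes "\<And>xs. bij (q xs)" "\<And>xs. q xs \<noteq> id \<Longrightarrow> length xs < length v"
  shows "tree_map q \<circ> tree_map (single v k) = tree_map (single (tree_map q v) k) \<circ> tree_map q"
proof -
  have "q (tree_map (single v k) xs) \<circ> single v k xs = single (tree_map q v) k (tree_map q xs) \<circ> q xs" for xs
  proof (cases "length xs < length v")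
    case True
    then have "tree_map (single v k) xs = xs" by (intro tree_map_fixed single_other) auto
    moreover have "xs \<noteq> v" "tree_map q xs \<noteq> tree_map q v"
      using True by (auto dest: arg_cong[where f = length])
    ultimately show ?thesis by simp
  next
    case False
    then have "q xs = id" "q (tree_map (single v k) xs) = id"
      using assms(2) by (metis length_tree_map)+
    moreover have "tree_map q xs = tree_map q v \<longleftrightarrow> xs = v"
      using bij_tree_map[of q, OF assms(1)] by (auto simp: bij_def dest: injD)
    ultimately show ?thesis by (simp add: single_def)
  qed
  then show ?thesis by (simp add: tree_map_comp)
qed

text \<open>By injectivity, a point that \<open>f\<close> moves goes to a point that
  \<open>f\<close> moves, which \<open>g\<close> therefore fixes; the same holds with the roles
  exchanged.\<close>

lemma comp_commute_disjoint_moves: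
  assumes "inj f" "inj g" "\<And>x. f x = x \<or> g x = x"
  shows "f \<circ> g = g \<circ> f"
proof
  fix x
  show "(f \<circ> g) x = (g \<circ> f) x"
  proof (cases "f x = x")
    case True
    have "g (f (g x)) = g (g x) \<longrightarrow> f (g x) = g x" using assms(2) by (blast dest: injD)
    moreover have "g (g x) = g x \<longrightarrow> g x = x" using assms(2) by (blast dest: injD)
    ultimately show ?thesis using assms(3)[of "g x"] True by auto
  next
    case False
    have "f (f x) = f x \<longrightarrow> f x = x" using assms(1) by (blast dest: injD)
    with False show ?thesis using assms(3)[of "f x"] assms(3)[of x] by auto
  qed
qed

lemma finite_nlists: "finite X \<Longrightarrow> finite (nlists n X)"
  using finite_lists_length_eq[of X n] by (simp add: nlists_def conj_commute)

section \<open>Faithful transitive actions and portraits with labels from the group\<close>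

locale finite_transitive_action = faithful_action H X \<phi> + transitive_action H X \<phi>
  for H (structure) and X :: "'a set" and \<phi> +
  assumes finite_points: "finite X" and points_nonempty: "X \<noteq> {}"
begin

sublocale act: group_hom H "BijGroup X" \<phi>
  by (rule group_hom)

lemma action_bij_betw: "h \<in> carrier H \<Longrightarrow> bij_betw (\<phi> h) X X"
  using bij_prop0 by (auto simp: Bij_def)

lemma action_closed: "h \<in> carrier H \<Longrightarrow> x \<in> X \<Longrightarrow> \<phi> h x \<in> X"
  using action_bij_betw bij_betwE by blast

lemma action_mult:
  assumes "g \<in> carrier H" "h \<in> carrier H"
  shows "\<phi> (g \<otimes> h) = compose X (\<phi> g) (\<phi> h)"
  using act.hom_mult[OF assms] bij_prop0[OF assms(1)] bij_prop0[OF assms(2)]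
  by (simp add: BijGroup_def)

text \<open>Extending the permutations of \<open>X\<close> by the identity turns the group operation into plain
  composition, and portraits then define bijections of all lists over the type.\<close>

definition perm :: "_ \<Rightarrow> 'a \<Rightarrow> 'a" where
  "perm h = (\<lambda>x. if x \<in> X then \<phi> h x else x)"

definition perms :: "('a \<Rightarrow> 'a) set" where
  "perms = perm ` carrier H"

lemma perm_in_perms [simp]: "h \<in> carrier H \<Longrightarrow> perm h \<in> perms"
  by (simp add: perms_def)

lemma restrict_perm: "h \<in> carrier H \<Longrightarrow> restrict (perm h) X = \<phi> h"
  using bij_prop0[THEN Bij_imp_extensional]
  by (intro extensionalityI[where A = X]) (auto simp: perm_def)

lemma perm_one: "perm \<one> = id"
  unfolding perm_def id_eq_one[symmetric] by auto

lemma perm_mult: "g \<in> carrier H \<Longrightarrow> h \<in> carrier H \<Longrightarrow> perm (g \<otimes> h) = perm g \<circ> perm h"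
  by (auto simp: perm_def fun_eq_iff action_mult compose_eq action_closed simp del: act.hom_mult)

lemma perm_inv_comp:
  assumes "h \<in> carrier H"
  shows "perm h \<circ> perm (inv h) = id" "perm (inv h) \<circ> perm h = id"
  using assms by (simp_all flip: perm_mult add: perm_one)

lemma bij_perm: "h \<in> carrier H \<Longrightarrow> bij (perm h)"
  using perm_inv_comp o_bij by blast

lemma inv_perm: "h \<in> carrier H \<Longrightarrow> inv_into UNIV (perm h) = perm (inv h)"
  using perm_inv_comp inv_unique_comp by blast

lemma perms_id: "id \<in> perms"
  using perm_one perm_in_perms[OF act.G.one_closed] by simp

lemma perms_comp: "k \<in> perms \<Longrightarrow> l \<in> perms \<Longrightarrow> k \<circ> l \<in> perms"
  by (auto simp: perms_def simp flip: perm_mult)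

lemma perms_inv: "k \<in> perms \<Longrightarrow> inv_into UNIV k \<in> perms"
  by (auto simp: perms_def inv_perm)

lemma perms_bij: "k \<in> perms \<Longrightarrow> bij k"
  by (auto simp: perms_def bij_perm)

lemma perms_closed: "k \<in> perms \<Longrightarrow> x \<in> X \<Longrightarrow> k x \<in> X"
  by (auto simp: perms_def perm_def action_closed)

lemma finite_perms: "finite perms"
proof -
  have "perms \<subseteq> (\<lambda>f x. if x \<in> X then f x else x) ` (X \<rightarrow>\<^sub>E X)"
  proof
    fix k assume "k \<in> perms"
    then have "restrict k X \<in> X \<rightarrow>\<^sub>E X" "k = (\<lambda>x. if x \<in> X then restrict k X x else x)"
      using perms_closed by (auto simp: perms_def perm_def)
    then show "k \<in> (\<lambda>f x. if x \<in> X then f x else x) ` (X \<rightarrow>\<^sub>E X)" by blast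
  qed
  then show ?thesis using finite_points by (meson finite_PiE finite_imageI finite_subset)
qed

lemma perms_transitive: "x \<in> X \<Longrightarrow> y \<in> X \<Longrightarrow> \<exists>k\<in>perms. k x = y"
  using unique_orbit[of x y] by (auto simp: perms_def perm_def)

lemma tree_map_closed: "range p \<subseteq> perms \<Longrightarrow> xs \<in> nlists n X \<Longrightarrow> tree_map p xs \<in> nlists n X"
proof (induction n arbitrary: xs)
  case (Suc n)
  from Suc.prems(2) show ?case
  proof (rule nlists_Suc_snocE)
    fix ys y assume ys: "xs = ys @ [y]" "ys \<in> nlists n X" "y \<in> X"
    have "p ys y \<in> X" using Suc.prems(1) ys(3) perms_closed by blast
    then show "tree_map p xs \<in> nlists (Suc n) X"
      using Suc.IH[OF Suc.prems(1) ys(2)] by (simp add: ys(1) nlists_snoc_iff)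
  qed
qed (simp add: nlists_def)

text \<open>The finitary automorphisms with labels on the first \<open>n\<close> levels. Words with
  letters outside \<open>X\<close> carry \<open>id\<close>, so each level has only finitely many
  vertices to treat.\<close>

definition portraits :: "nat \<Rightarrow> ('a list \<Rightarrow> 'a \<Rightarrow> 'a) set" where
  "portraits n = {p. range p \<subseteq> perms \<and> (\<forall>xs. p xs \<noteq> id \<longrightarrow> length xs < n \<and> set xs \<subseteq> X)}"

lemma single_in_portraits:
  "k \<in> perms \<Longrightarrow> v \<in> nlists m X \<Longrightarrow> m < n \<Longrightarrow> single v k \<in> portraits n"
  by (auto simp: portraits_def single_def perms_id nlists_def)

lemma portraits_bij: "p \<in> portraits n \<Longrightarrow> bij (p xs)"
  by (auto simp: portraits_def intro: perms_bij)

lemma portraits_transitive: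
  "v \<in> nlists n X \<Longrightarrow> w \<in> nlists n X \<Longrightarrow> \<exists>q\<in>portraits n. tree_map q v = w"
proof (induction n arbitrary: v w)
  case 0
  have "(\<lambda>_. id) \<in> portraits 0" by (simp add: portraits_def perms_id)
  with 0 show ?case by (auto simp: nlists_def)
next
  case (Suc n)
  obtain v' x where v: "v = v' @ [x]" "v' \<in> nlists n X" "x \<in> X"
    using Suc.prems(1) by (rule nlists_Suc_snocE)
  obtain w' y where w: "w = w' @ [y]" "w' \<in> nlists n X" "y \<in> X"
    using Suc.prems(2) by (rule nlists_Suc_snocE)
  obtain q where q: "q \<in> portraits n" "tree_map q v' = w'" using Suc.IH v(2) w(2) by blast
  obtain k where k: "k \<in> perms" "k x = y" using perms_transitive v(3) w(3) by blast
  \<comment> \<open>The label at \<open>v'\<close> does not affect the image of \<open>v'\<close>,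
    so it can be set to \<open>k\<close> after \<open>q\<close> has been chosen for the
    prefix.\<close>
  have "tree_map (q(v' := k)) v' = tree_map q v'" by (rule tree_map_cong) auto
  then have "tree_map (q(v' := k)) v = w" by (simp add: v(1) w(1) q(2) k(2))
  moreover have "q(v' := k) \<in> portraits (Suc n)"
    using q(1) k(1) v(2) by (force simp: portraits_def nlists_def)
  ultimately show ?case by blast
qed

end

text \<open>Working with any set closed under composition and inverses separates the combinatorics
  of the tree from the inverse limit. Later \<open>\<G>\<close> becomes the set of tree maps whose
  truncations lie in the subgroup generated by the chosen elements.\<close>

locale tree_map_group = finite_transitive_action H X \<phi>
  for H (structure) and X :: "'a set" and \<phi> +
  fixes \<G> :: "('a list \<Rightarrow> 'a list) set"
  assumes id_closed: "id \<in> \<G>"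
    and comp_closed: "f \<in> \<G> \<Longrightarrow> g \<in> \<G> \<Longrightarrow> f \<circ> g \<in> \<G>"
    and inv_closed: "f \<in> \<G> \<Longrightarrow> inv_into UNIV f \<in> \<G>"
begin

text \<open>One vertex suffices for a level: conjugation by elements acting on the levels above
  carries its labels to every vertex of level \<open>n\<close>, finite products fill the level, and
  a portrait with one more level factors into its upper levels and its last one.\<close>

lemma level_step:
  assumes n: "tree_map ` portraits n \<subseteq> \<G>" and v: "v \<in> nlists n X"
    and single: "\<And>k. k \<in> perms \<Longrightarrow> tree_map (single v k) \<in> \<G>"
  shows "tree_map ` portraits (Suc n) \<subseteq> \<G>"
proof -
  have level: "tree_map (single w k) \<in> \<G>" if w: "w \<in> nlists n X" and k: "k \<in> perms" for w k
  proof -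
    obtain q where q: "q \<in> portraits n" "tree_map q v = w" using portraits_transitive v w by blast
    have "tree_map q \<circ> tree_map (single v k) = tree_map (single w k) \<circ> tree_map q"
      unfolding q(2)[symmetric]
      using q(1) v by (intro tree_map_conj_single portraits_bij) (auto simp: portraits_def nlists_def)
    moreover have "bij (tree_map q)" by (rule bij_tree_map[OF portraits_bij[OF q(1)]])
    ultimately have "tree_map (single w k) = tree_map q \<circ> tree_map (single v k) \<circ> inv_into UNIV (tree_map q)"
      by (metis bij_is_surj comp_assoc comp_id surj_iff)
    then show ?thesis using n q(1) single[OF k] by (auto intro!: comp_closed inv_closed)
  qed
  have layer: "tree_map (\<lambda>xs. if xs \<in> A then p xs else id) \<in> \<G>"
    if "range p \<subseteq> perms" "finite A" "A \<subseteq> nlists n X" for A p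
    using that(2,3)
  proof (induction A)
    case empty
    show ?case using id_closed by (simp only: empty_iff if_False tree_map_id)
  next
    case (insert w A)
    let ?r = "\<lambda>xs. if xs \<in> A then p xs else id"
    have "tree_map (single w (p w)) \<circ> tree_map ?r = tree_map (\<lambda>xs. single w (p w) xs \<circ> ?r xs)"
      using insert.prems
      by (intro tree_map_comp_levels[where n = n]) (auto simp: single_def nlists_def split: if_splits)
    moreover have "(\<lambda>xs. single w (p w) xs \<circ> ?r xs) = (\<lambda>xs. if xs \<in> insert w A then p xs else id)"
      using insert.hyps(2) by (auto simp: single_def)
    ultimately show ?case
      using comp_closed[OF level[of w "p w"], of "tree_map ?r"] insert that(1) by auto
  qed
  note fin = finite_nlists[OF finite_points, of n]
  show ?thesis
  proof safe
    fix p assume p: "p \<in> portraits (Suc n)"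
    let ?q = "\<lambda>xs. if length xs < n then p xs else id" and ?r = "\<lambda>xs. if xs \<in> nlists n X then p xs else id"
    have "tree_map ?q \<circ> tree_map ?r = tree_map (\<lambda>xs. ?q xs \<circ> ?r xs)"
      by (intro tree_map_comp_levels[where n = n]) (auto simp: nlists_def split: if_splits)
    moreover have "(\<lambda>xs. ?q xs \<circ> ?r xs) = p"
    proof
      show "?q xs \<circ> ?r xs = p xs" for xs
        using p by (cases "p xs = id") (auto simp: portraits_def nlists_def)
    qed
    moreover have "tree_map ?q \<in> \<G>"
      using n p perms_id by (intro subsetD[OF n] imageI) (auto simp: portraits_def)
    moreover have "tree_map ?r \<in> \<G>"
      using p fin by (intro layer) (auto simp: portraits_def)
    ultimately show "tree_map p \<in> \<G>"
      using comp_closed[of "tree_map ?q" "tree_map ?r"] by (simp only:)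
  qed
qed

end

section \<open>Generators in the perfect case\<close>

text \<open>The vertices \<open>a\<^sup>m\<^sup>+\<^sup>2\<^sup>i b a\<close> carrying the label \<open>k\<close> leave the ray \<open>a a a \<dots>\<close>. Spacing them two
  levels apart keeps the first one out of reach of the conjugation in \<open>commutator_single\<close>.\<close>

definition spine :: "'a \<Rightarrow> 'a \<Rightarrow> nat \<Rightarrow> ('a \<Rightarrow> 'a) \<Rightarrow> 'a list \<Rightarrow> 'a \<Rightarrow> 'a" where
  "spine a b m k = (\<lambda>xs. if \<exists>i. xs = replicate (m + 2 * i) a @ [b, a] then k else id)"

text \<open>The vertex split off has length \<open>m + 2\<close> and the others have length at least
  \<open>m + 4\<close>, so \<open>tree_map_comp_levels\<close> multiplies the labels
  pointwise.\<close>

lemma tree_map_spine_step: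
  "tree_map (spine a b m k) =
    tree_map (single (replicate m a @ [b, a]) k) \<circ> tree_map (spine a b (m + 2) k)"
proof -
  have "spine a b m k = (\<lambda>xs. single (replicate m a @ [b, a]) k xs \<circ> spine a b (m + 2) k xs)"
  proof
    fix xs
    have "(\<exists>i. xs = replicate (m + 2 * i) a @ [b, a]) \<longleftrightarrow>
        xs = replicate m a @ [b, a] \<or> (\<exists>i. xs = replicate (m + 2 + 2 * i) a @ [b, a])" (is "?L \<longleftrightarrow> ?R")
    proof
      assume ?L
      then obtain i where i: "xs = replicate (m + 2 * i) a @ [b, a]" ..
      show ?R
      proof (cases i)
        case (Suc j)
        then have "m + 2 * i = m + 2 + 2 * j" by simp
        then show ?R using i by metis
      qed (use i in simp)
    next
      assume ?R
      then show ?L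
      proof
        assume "xs = replicate m a @ [b, a]"
        then have "xs = replicate (m + 2 * 0) a @ [b, a]" by simp
        then show ?L by blast
      next
        assume "\<exists>i. xs = replicate (m + 2 + 2 * i) a @ [b, a]"
        then obtain i where "xs = replicate (m + 2 * Suc i) a @ [b, a]" by auto
        then show ?L by blast
      qed
    qed
    moreover have "xs = replicate m a @ [b, a] \<Longrightarrow> \<not> (\<exists>i. xs = replicate (m + 2 + 2 * i) a @ [b, a])"
      by (auto dest: arg_cong[where f = length])
    ultimately show "spine a b m k xs = single (replicate m a @ [b, a]) k xs \<circ> spine a b (m + 2) k xs"
      by (auto simp: spine_def single_def simp del: replicate_add)
  qed
  moreover have "tree_map (single (replicate m a @ [b, a]) k) \<circ> tree_map (spine a b (m + 2) k) =
      tree_map (\<lambda>xs. single (replicate m a @ [b, a]) k xs \<circ> spine a b (m + 2) k xs)"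
    by (intro tree_map_comp_levels[where n = "m + 2"]) (auto simp: single_def spine_def split: if_splits)
  ultimately show ?thesis by simp
qed

lemma tree_map_spine_moves:
  assumes "tree_map (spine a b m k) xs \<noteq> xs"
  shows "\<exists>ys. xs = replicate m a @ ys"
proof (rule ccontr)
  assume *: "\<nexists>ys. xs = replicate m a @ ys"
  have "tree_map (spine a b m k) xs = xs"
  proof (rule tree_map_fixed)
    fix ys x zs assume xs: "xs = ys @ x # zs"
    show "spine a b m k ys = id"
    proof (rule ccontr)
      assume "spine a b m k ys \<noteq> id"
      then obtain i where "ys = replicate (m + 2 * i) a @ [b, a]"
        by (auto simp: spine_def split: if_splits)
      then show False using * xs by (simp add: replicate_add)
    qed
  qed
  with assms show False by simp
qed

lemma bij_single: "bij k \<Longrightarrow> bij (single v k xs)"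
  by (simp add: single_def)

lemma bij_spine: "bij k \<Longrightarrow> bij (spine a b m k xs)"
  by (simp add: spine_def)

context tree_map_group
begin

text \<open>Conjugating by an element at the vertex \<open>a\<^sup>m\<^sup>+\<^sup>1\<close> fixes the first vertex of the spine and moves
  all the others off the ray, so that in the commutator of a spine with a conjugated spine only
  the commutator of the two first labels survives.\<close>

lemma commutator_single:
  assumes a: "a \<in> X" and b: "b \<in> X" and ab: "a \<noteq> b"
    and n: "tree_map ` portraits (m + 2) \<subseteq> \<G>"
    and spine: "\<And>k. k \<in> perms \<Longrightarrow> tree_map (spine a b m k) \<in> \<G>"
    and k: "k \<in> perms" and l: "l \<in> perms" and c: "c \<circ> l \<circ> k = k \<circ> l"
  shows "tree_map (single (replicate m a @ [b, a]) c) \<in> \<G>"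
proof -
  \<comment> \<open>\<open>v\<close> is the first vertex of the spine, \<open>D\<close> puts a label
    there, and \<open>A\<close> is the rest of the spine, whose vertices all begin with
    \<open>m + 2\<close> letters \<open>a\<close>.\<close>
  define v where "v = replicate m a @ [b, a]"
  define D where "D = (\<lambda>k. tree_map (single v k))"
  define A where "A = (\<lambda>k. tree_map (spine a b (m + 2) k))"
  obtain g where g: "g \<in> perms" "g a = b" using perms_transitive[OF a b] by blast
  \<comment> \<open>\<open>G\<close> turns the letter \<open>a\<close> after the prefix
    \<open>a^(m+1)\<close> into \<open>b\<close>, so \<open>C\<close> is the rest of the spine of
    \<open>l\<close> carried off the ray.\<close>
  define G where "G = tree_map (single (replicate (m + 1) a) g)"
  define C where "C = G \<circ> A l \<circ> inv_into UNIV G"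
  have bij: "bij k" "bij l" "bij g" using k l g perms_bij by auto
  have bijG: "bij G" unfolding G_def by (intro bij_tree_map bij_single bij)
  have bijA: "bij (A k)" "bij (A l)" unfolding A_def by (intro bij_tree_map bij_spine bij)+
  have bijD: "bij (D k)" "bij (D l)" unfolding D_def by (intro bij_tree_map bij_single bij)+
  have bijC: "bij C" unfolding C_def using bijA bijG by (intro bij_comp bij_imp_bij_inv)
  have GG: "G \<in> \<G>"
    unfolding G_def using g a
    by (intro subsetD[OF n] imageI single_in_portraits[where m = "m + 1"]) (auto simp: nlists_def)
  have rep: "(replicate n a @ ys) ! i = a" if "i < n" for n ys i
    using that by (simp add: nth_append)
  \<comment> \<open>The letters at positions \<open>m\<close> and \<open>m + 1\<close> separate the
    supports: \<open>a a\<close> for \<open>A\<close>, \<open>b\<close> at position \<open>m\<close>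
    for \<open>D\<close>, and \<open>a b\<close> for \<open>C\<close>. As \<open>a\<close> and
    \<open>b\<close> differ, maps of different kinds commute.\<close>
  have movesA: "xs ! m = a \<and> xs ! Suc m = a" if A: "A k xs \<noteq> xs" for k xs
  proof -
    obtain ys where "xs = replicate (m + 2) a @ ys"
      using tree_map_spine_moves[of a b "m + 2" k xs] A unfolding A_def by blast
    then show ?thesis using rep[of m "m + 2" ys] rep[of "Suc m" "m + 2" ys] by simp
  qed
  have movesD: "xs ! m = b" if "D k xs \<noteq> xs" for k xs
    using tree_map_single_moves[of v k xs] that by (auto simp: D_def v_def nth_append)
  have movesC: "xs ! m = a \<and> xs ! Suc m = b" if C: "C xs \<noteq> xs" for xs
  proof -
    let ?ys = "inv_into UNIV G xs"
    have xs: "xs = G ?ys" using bijG by (simp add: bij_is_surj surj_f_inv_f)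
    then have "A l ?ys \<noteq> ?ys" using C by (auto simp: C_def)
    then obtain zs where "?ys = replicate (m + 2) a @ zs"
      using tree_map_spine_moves[of a b "m + 2" l ?ys] unfolding A_def by blast
    moreover have "replicate (m + 2) a @ zs = replicate (m + 1) a @ a # zs"
      by (simp flip: replicate_append_same)
    ultimately have "xs = G (replicate (m + 1) a @ a # zs)" using xs by metis
    then have "xs = replicate (m + 1) a @ b # zs"
      by (simp only: G_def tree_map_single_below g(2))
    then show ?thesis
      using rep[of m "m + 1" "b # zs"] nth_append_length[of "replicate (m + 1) a" b zs] by simp
  qed
  \<comment> \<open>\<open>v\<close> has \<open>b\<close> at position \<open>m\<close>, so it does
    not lie below the prefix \<open>a^(m+1)\<close> where \<open>G\<close> acts.\<close>
  have "G v = v"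
    unfolding G_def
  proof (rule ccontr)
    assume "tree_map (single (replicate (m + 1) a) g) v \<noteq> v"
    from tree_map_single_moves[OF this] obtain x ys where "v = replicate (m + 1) a @ x # ys" by blast
    then have "v ! m = a" using rep[of m "m + 1" "x # ys"] by simp
    then show False using ab by (simp add: v_def nth_append)
  qed
  have GD: "G \<circ> D l = D l \<circ> G"
  proof -
    have deep: "length xs < length v" if "single (replicate (m + 1) a) g xs \<noteq> id" for xs
      using that by (auto simp: single_def v_def split: if_splits)
    have "G \<circ> D l = tree_map (single (G v) l) \<circ> G"
      unfolding G_def D_def by (rule tree_map_conj_single) (rule bij_single[OF bij(3)], erule deep)
    then show ?thesis by (simp only: D_def \<open>G v = v\<close>)
  qed
  have AD: "A k \<circ> D l = D l \<circ> A k"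
    using movesA movesD ab bijA bijD by (intro comp_commute_disjoint_moves bij_is_inj) metis+
  have CD: "C \<circ> D k = D k \<circ> C"
    using movesC movesD ab bijC bijD by (intro comp_commute_disjoint_moves bij_is_inj) metis+
  have AC: "A k \<circ> C = C \<circ> A k"
    using movesA movesC ab bijA bijC by (intro comp_commute_disjoint_moves bij_is_inj) metis+
  define P where "P = D k \<circ> A k"
  define Q where "Q = D l \<circ> C"
  have P: "P \<in> \<G>"
    using spine[OF k] unfolding tree_map_spine_step[of a b m] P_def D_def A_def v_def .
  \<comment> \<open>Since \<open>G\<close> commutes with \<open>D l\<close>, conjugating the spine
    of \<open>l\<close> by \<open>G\<close> displaces only the rest and leaves the first label in
    place.\<close>
  have "Q = G \<circ> tree_map (spine a b m l) \<circ> inv_into UNIV G"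
  proof -
    have "tree_map (spine a b m l) = D l \<circ> A l"
      unfolding D_def A_def v_def by (rule tree_map_spine_step)
    then have "G \<circ> tree_map (spine a b m l) \<circ> inv_into UNIV G = (G \<circ> D l) \<circ> (A l \<circ> inv_into UNIV G)"
      by (simp only: comp_assoc)
    then show ?thesis by (simp only: GD Q_def C_def comp_assoc)
  qed
  then have Q: "Q \<in> \<G>"
    using GG spine[OF l] by (simp add: comp_closed inv_closed)
  \<comment> \<open>The commuting factors \<open>A k\<close> and \<open>C\<close> occur in both
    \<open>Q \<circ> P\<close> and \<open>P \<circ> Q\<close>; the two products differ only in the
    order of the labels at \<open>v\<close>, which \<open>c\<close> corrects.\<close>
  have "D c \<circ> (Q \<circ> P) = D c \<circ> D l \<circ> (C \<circ> D k) \<circ> A k"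
    by (simp add: Q_def P_def comp_assoc)
  also have "\<dots> = D c \<circ> D l \<circ> D k \<circ> (A k \<circ> C)"
    by (simp only: CD AC comp_assoc)
  also have "D c \<circ> D l \<circ> D k = D k \<circ> D l"
    by (simp add: D_def tree_map_single_comp c)
  also have "D k \<circ> D l \<circ> (A k \<circ> C) = D k \<circ> (D l \<circ> A k) \<circ> C"
    by (simp only: comp_assoc)
  also have "\<dots> = P \<circ> Q"
    by (simp only: AD[symmetric] P_def Q_def comp_assoc)
  finally have "D c \<circ> (Q \<circ> P) = P \<circ> Q" .
  moreover have "bij (Q \<circ> P)"
    unfolding P_def Q_def by (intro bij_comp bijA bijC bijD)
  ultimately have "D c = (P \<circ> Q) \<circ> inv_into UNIV (Q \<circ> P)"
    by (metis bij_is_surj comp_assoc comp_id surj_iff)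
  then show ?thesis
    using comp_closed[OF comp_closed[OF P Q] inv_closed[OF comp_closed[OF Q P]]]
    by (simp only: D_def v_def)
qed

text \<open>The map \<open>g \<mapsto> tree_map (single v (perm g))\<close> is multiplicative, so
  the elements it sends into \<open>\<G>\<close> form a subgroup. It contains all commutators, and
  these generate a perfect \<open>H\<close>.\<close>

lemma single_mem_of_perfect:
  assumes perfect: "perfect_group H"
    and commutator: "\<And>k l c. k \<in> perms \<Longrightarrow> l \<in> perms \<Longrightarrow> c \<circ> l \<circ> k = k \<circ> l \<Longrightarrow> tree_map (single v c) \<in> \<G>"
    and "k \<in> perms"
  shows "tree_map (single v k) \<in> \<G>"
proof -
  obtain h where h: "h \<in> carrier H" "k = perm h" using assms(3) by (auto simp: perms_def)
  have commutators: "g \<in> carrier H \<and> tree_map (single v (perm g)) \<in> \<G>" if g: "g \<in> derived_set H (carrier H)" for g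
  proof -
    obtain x y where xy: "x \<in> carrier H" "y \<in> carrier H" "g = x \<otimes> y \<otimes> inv x \<otimes> inv y"
      using g by blast
    \<comment> \<open>The commutator equation cleared of inverses, which is the form that the
      hypothesis on \<open>c\<close> takes.\<close>
    then have "g \<otimes> y \<otimes> x = x \<otimes> y" by (simp add: act.G.m_assoc)
    then have "perm g \<circ> perm y \<circ> perm x = perm x \<circ> perm y"
      using xy by (simp flip: perm_mult)
    then show ?thesis using xy commutator[of "perm x" "perm y" "perm g"] by simp
  qed
  have "h \<in> generate H (derived_set H (carrier H))"
    using perfect h by (simp add: perfect_group_def derived_def)
  then have "h \<in> carrier H \<and> tree_map (single v (perm h)) \<in> \<G>"
  proof induction
    case one
    show ?case
      by (simp only: act.G.one_closed perm_one single_id tree_map_id id_closed simp_thms)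
  next
    case (incl g)
    then show ?case by (rule commutators)
  next
    case (inv g)
    then have g: "g \<in> carrier H" "tree_map (single v (perm g)) \<in> \<G>"
      using commutators[of g] by blast+
    have "inv_into UNIV (tree_map (single v (perm g))) = tree_map (single v (perm (inv g)))"
      by (rule inv_unique_comp) (simp_all only: tree_map_single_comp perm_inv_comp g single_id tree_map_id)
    then show ?case using g inv_closed[OF g(2)] by simp
  next
    case (eng g1 g2)
    then show ?case
      by (simp only: perm_mult tree_map_single_comp[symmetric] comp_closed act.G.m_closed)
  qed
  then show ?thesis using h by simp
qed

text \<open>The spine starting at \<open>m\<close> yields all labels at its first vertex, which lies
  on level \<open>m + 2\<close>, and hence that whole level. Two spines are kept because each serves
  only every second level.\<close>

lemma finitary_portraits_generated:
  assumes perfect: "perfect_group H"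
    and a: "a \<in> X" and b: "b \<in> X" and ab: "a \<noteq> b"
    and gens: "\<And>k. k \<in> perms \<Longrightarrow> {tree_map (single [] k), tree_map (single [a] k),
        tree_map (spine a b 0 k), tree_map (spine a b 1 k)} \<subseteq> \<G>"
  shows "tree_map ` portraits n \<subseteq> \<G>"
proof -
  have "tree_map ` portraits 0 \<subseteq> \<G>"
  proof -
    have "portraits 0 \<subseteq> {\<lambda>_. id}" by (auto simp: portraits_def)
    then show ?thesis using id_closed by fastforce
  qed
  then have 1: "tree_map ` portraits 1 \<subseteq> \<G>"
    unfolding One_nat_def using gens by (intro level_step[of 0 "[]"]) (auto simp: nlists_def)
  \<comment> \<open>The root and the vertex \<open>[a]\<close> settle levels 0 and 1, which is what
    the commutator argument needs for \<open>m = 0\<close>.\<close>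
  then have 2: "tree_map ` portraits 2 \<subseteq> \<G>"
    unfolding numeral_2_eq_2 using gens a
    by (intro level_step[of "Suc 0" "[a]"]) (auto simp: nlists_def)
  have main: "tree_map ` portraits (m + 2) \<subseteq> \<G> \<and>
      (\<forall>k\<in>perms. tree_map (spine a b m k) \<in> \<G> \<and> tree_map (spine a b (Suc m) k) \<in> \<G>)" for m
  proof (induction m)
    case 0
    show ?case using 2 gens by (simp add: numeral_2_eq_2)
  next
    case (Suc m)
    let ?v = "replicate m a @ [b, a]"
    have single: "tree_map (single ?v k) \<in> \<G>" if "k \<in> perms" for k
      using Suc by (intro single_mem_of_perfect[OF perfect _ that] commutator_single a b ab) auto
    \<comment> \<open>Dividing the spine by its first label, which is now available, leaves the
      spine that starts two levels lower.\<close>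
    have "tree_map (spine a b (m + 2) k) \<in> \<G>" if "k \<in> perms" for k
    proof -
      have "bij (tree_map (single ?v k))" using perms_bij[OF that] by (intro bij_tree_map bij_single)
      then have "tree_map (spine a b (m + 2) k) =
          inv_into UNIV (tree_map (single ?v k)) \<circ> tree_map (spine a b m k)"
        unfolding tree_map_spine_step[of a b m] by (metis bij_is_inj comp_assoc id_comp inv_o_cancel)
      moreover have "tree_map (spine a b m k) \<in> \<G>" using Suc that by blast
      ultimately show ?thesis
        using comp_closed[OF inv_closed[OF single[OF that]]] by (simp only:)
    qed
    moreover have "?v \<in> nlists (m + 2) X" using a b by (auto simp: nlists_def)
    then have "tree_map ` portraits (Suc (m + 2)) \<subseteq> \<G>"
      using Suc single by (intro level_step) auto
    ultimately show ?case using Suc by simp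
  qed
  have "portraits n \<subseteq> portraits (n + 2)" by (auto simp: portraits_def)
  then show ?thesis using main[of n] by blast
qed

end

section \<open>Truncations and density\<close>

lemma inverse_limit_carrier_iff:
  "s \<in> carrier (inverse_limit G \<pi>) \<longleftrightarrow> (\<forall>n. s n \<in> carrier (G n)) \<and> (\<forall>n. \<pi> n (s (Suc n)) = s n)"
  by (auto simp: inverse_limit_def PiE_iff)

lemma inverse_limit_eq_below:
  assumes "s \<in> carrier (inverse_limit G \<pi>)" "t \<in> carrier (inverse_limit G \<pi>)" "s n = t n" "m \<le> n"
  shows "s m = t m"
  using assms(4,3)
proof (induction rule: inc_induct)
  case (step m)
  then show ?case using assms(1,2) by (metis inverse_limit_carrier_iff)
qed

text \<open>A basic open set restricts finitely many coordinates, and in an inverse limit a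
  coordinate determines all those of smaller index. Density is thus approximation in one coordinate
  at a time.\<close>

lemma inverse_limit_closure_of_eq_topspace_iff:
  assumes D: "D \<subseteq> carrier (inverse_limit G \<pi>)"
  shows "Abstract_Topology.closure_of (inverse_limit_topology G \<pi>) D = topspace (inverse_limit_topology G \<pi>)
    \<longleftrightarrow> (\<forall>s\<in>carrier (inverse_limit G \<pi>). \<forall>n. \<exists>t\<in>D. t n = s n)"
    (is "?closure = _ \<longleftrightarrow> ?R")
proof -
  let ?L = "carrier (inverse_limit G \<pi>)"
  let ?P = "product_topology (\<lambda>n. discrete_topology (carrier (G n))) UNIV"
  let ?T = "inverse_limit_topology G \<pi>"
  have top: "topspace ?T = ?L"
    by (auto simp: inverse_limit_topology_def inverse_limit_carrier_iff)
  have "?closure = topspace ?T \<longleftrightarrow> ?L \<subseteq> ?closure"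
    using closure_of_subset_topspace[of ?T D] top by auto
  also have "\<dots> \<longleftrightarrow> ?R"
  proof
    assume dense: "?L \<subseteq> ?closure"
    show ?R
    proof (intro ballI allI)
      fix s n assume s: "s \<in> ?L"
      let ?U = "\<lambda>i. if i = n then {s n} else carrier (G i)"
      have "openin ?P (Pi\<^sub>E UNIV ?U)"
        unfolding openin_PiE_gen using s
        by (auto simp: inverse_limit_carrier_iff intro: rev_finite_subset[of "{n}"])
      then have "openin ?T (?L \<inter> Pi\<^sub>E UNIV ?U)"
        unfolding inverse_limit_topology_def openin_subtopology by blast
      moreover have "s \<in> ?L \<inter> Pi\<^sub>E UNIV ?U"
        using s by (auto simp: inverse_limit_carrier_iff)
      moreover have "\<forall>V. s \<in> V \<and> openin ?T V \<longrightarrow> (\<exists>t. t \<in> D \<and> t \<in> V)"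
        using subsetD[OF dense s] unfolding in_closure_of by blast
      ultimately obtain t where "t \<in> D" "t \<in> ?L \<inter> Pi\<^sub>E UNIV ?U"
        by meson
      then show "\<exists>t\<in>D. t n = s n" by (auto simp: PiE_iff split: if_splits)
    qed
  next
    assume approx: ?R
    show "?L \<subseteq> ?closure"
    proof
      fix s assume s: "s \<in> ?L"
      have "\<exists>t. t \<in> D \<and> t \<in> V" if sV: "s \<in> V" and V: "openin ?T V" for V
      proof -
        obtain S where S: "openin ?P S" "V = S \<inter> ?L"
          using V unfolding inverse_limit_topology_def openin_subtopology by blast
        then obtain U where U: "finite {i. U i \<noteq> carrier (G i)}" "s \<in> Pi\<^sub>E UNIV U" "Pi\<^sub>E UNIV U \<subseteq> S"
          using sV unfolding openin_product_topology_alt by auto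
        obtain n where n: "\<And>i. U i \<noteq> carrier (G i) \<Longrightarrow> i \<le> n"
          using U(1) by (meson finite_nat_set_iff_bounded_le mem_Collect_eq)
        obtain t where t: "t \<in> D" "t n = s n" using approx s by blast
        have "t i \<in> U i" for i
        proof (cases "U i = carrier (G i)")
          case True
          then show ?thesis using t(1) D by (auto simp: inverse_limit_carrier_iff)
        next
          case False
          then have "t i = s i"
            using inverse_limit_eq_below[of t G \<pi> s n i] t D s n by blast
          then show ?thesis using U(2) by auto
        qed
        then have "t \<in> Pi\<^sub>E UNIV U" by (simp add: PiE_iff)
        then show ?thesis using U(3) S(2) t(1) D by blast
      qed
      then show "s \<in> ?closure" using s top unfolding in_closure_of by blast
    qed
  qed
  finally show ?thesis .
qed

lemma Bij_subset_PiE: "Bij S \<subseteq> S \<rightarrow>\<^sub>E S"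
  by (auto simp: Bij_def PiE_def dest: bij_betw_imp_funcset)

definition truncations :: "'a set \<Rightarrow> ('a list \<Rightarrow> 'a list) \<Rightarrow> nat \<Rightarrow> 'a list \<Rightarrow> 'a list" where
  "truncations X f n = restrict f (nlists n X)"

section \<open>Wreath powers as truncated tree maps\<close>

context finite_transitive_action
begin

abbreviation W :: "nat \<Rightarrow> ('a list \<Rightarrow> 'a list) set" where
  "W \<equiv> wreath_power (\<phi> ` carrier H) X"

abbreviation W_inf :: "(nat \<Rightarrow> 'a list \<Rightarrow> 'a list) monoid" where
  "W_inf \<equiv> infinite_wreath_power (\<phi> ` carrier H) X"

lemma subgroup_image: "subgroup (\<phi> ` carrier H) (BijGroup X)"
  by (rule act.img_is_subgroup)

lemma group_W_inf: "group W_inf"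
  using group_infinite_wreath_power[OF subgroup_image points_nonempty] .

lemma W_bij: "f \<in> W n \<Longrightarrow> f \<in> Bij (nlists n X)"
  using wreath_power_Bij[OF subgroup_BijGroupD(1)[OF subgroup_image]] by blast

lemma W_inf_carrier_iff:
  "s \<in> carrier W_inf \<longleftrightarrow> (\<forall>n. s n \<in> W n) \<and> (\<forall>n. wreath_proj X n (s (Suc n)) = s n)"
  by (simp add: infinite_wreath_power_def inverse_limit_carrier_iff perm_group_def)

lemma W_inf_mult:
  assumes "s \<in> carrier W_inf" "t \<in> carrier W_inf"
  shows "(s \<otimes>\<^bsub>W_inf\<^esub> t) n = compose (nlists n X) (s n) (t n)"
  using assms W_bij unfolding W_inf_carrier_iff
  by (simp add: infinite_wreath_power_def inverse_limit_def perm_group_def BijGroup_def)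

lemma restrict_perms: "k \<in> perms \<Longrightarrow> restrict k X \<in> \<phi> ` carrier H"
  by (auto simp: perms_def restrict_perm)

lemma restrict_tree_map_snoc:
  assumes "range p \<subseteq> perms" "xs \<in> nlists n X" "x \<in> X"
  shows "truncations X (tree_map p) (Suc n) (xs @ [x]) =
    truncations X (tree_map p) n xs @ [restrict (p xs) X x]"
  using assms by (simp add: truncations_def nlists_snoc_iff)

lemma truncations_in_W: "range p \<subseteq> perms \<Longrightarrow> truncations X (tree_map p) n \<in> W n"
proof (induction n)
  case 0
  then show ?case by (auto simp: truncations_def nlists_def)
next
  case (Suc n)
  have "(\<lambda>xs. restrict (p xs) X) \<in> nlists n X \<rightarrow> \<phi> ` carrier H"
    using Suc.prems restrict_perms by blast
  moreover have "truncations X (tree_map p) (Suc n) \<in> extensional (nlists (Suc n) X)"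
    by (simp add: truncations_def)
  ultimately show ?case
    unfolding wreath_power_Suc_iff using restrict_tree_map_snoc[OF Suc.prems]
    by (intro conjI bexI[OF _ Suc.IH[OF Suc.prems]] bexI[of _ "\<lambda>xs. restrict (p xs) X"]) auto
qed

lemma truncations_in_W_inf: "range p \<subseteq> perms \<Longrightarrow> truncations X (tree_map p) \<in> carrier W_inf"
  unfolding W_inf_carrier_iff
  using wreath_proj_eq[OF points_nonempty truncations_in_W restrict_tree_map_snoc] truncations_in_W
  by blast

text \<open>Tree maps with labels in \<open>perms\<close> preserve the words over \<open>X\<close>
  of each length, so restriction to these words respects composition.\<close>

lemma truncations_comp:
  assumes p: "range p \<subseteq> perms" and q: "range q \<subseteq> perms"
  shows "truncations X (tree_map p \<circ> tree_map q) =
    truncations X (tree_map p) \<otimes>\<^bsub>W_inf\<^esub> truncations X (tree_map q)"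
proof (intro ext)
  fix n xs
  show "truncations X (tree_map p \<circ> tree_map q) n xs =
      (truncations X (tree_map p) \<otimes>\<^bsub>W_inf\<^esub> truncations X (tree_map q)) n xs"
    using tree_map_closed[OF q, of xs n]
    by (simp add: W_inf_mult truncations_in_W_inf p q)
      (simp add: truncations_def compose_def restrict_def)
qed

text \<open>The last factor of the wreath product supplies the labels on the last level. For density
  it is therefore enough to generate the finitary portraits.\<close>

lemma W_portraitE:
  assumes "f \<in> W n"
  obtains p where "p \<in> portraits n" "f = restrict (tree_map p) (nlists n X)"
proof -
  have "\<exists>p\<in>portraits n. f = restrict (tree_map p) (nlists n X)"
    using assms
  proof (induction n arbitrary: f)
    case 0
    have "(\<lambda>_. id) \<in> portraits 0" by (simp add: portraits_def perms_id)
    moreover have "f = restrict (tree_map (\<lambda>_. id)) (nlists 0 X)" using 0 by (auto simp: restrict_def)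
    ultimately show ?case by blast
  next
    case (Suc n)
    obtain g h where g: "g \<in> W n" and h: "h \<in> nlists n X \<rightarrow> \<phi> ` carrier H"
      and f: "\<And>xs x. xs \<in> nlists n X \<Longrightarrow> x \<in> X \<Longrightarrow> f (xs @ [x]) = g xs @ [h xs x]"
      using Suc.prems by (elim wreath_power_SucE) blast
    obtain q where q: "q \<in> portraits n" "g = restrict (tree_map q) (nlists n X)"
      using Suc.IH[OF g] by blast
    have "\<forall>xs\<in>nlists n X. \<exists>c\<in>carrier H. h xs = \<phi> c" using h by (auto simp: Pi_iff)
    then obtain c where c: "\<And>xs. xs \<in> nlists n X \<Longrightarrow> c xs \<in> carrier H \<and> h xs = \<phi> (c xs)"
      by metis
    \<comment> \<open>Overwriting \<open>q\<close> on level \<open>n\<close> leaves the images of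
      words of length \<open>n\<close> unchanged, since these depend on shorter prefixes
      only.\<close>
    let ?p = "\<lambda>xs. if xs \<in> nlists n X then perm (c xs) else q xs"
    have "?p \<in> portraits (Suc n)"
      using q(1) c by (auto simp: portraits_def nlists_def less_Suc_eq)
    moreover have "f = restrict (tree_map ?p) (nlists (Suc n) X)"
    proof (rule extensionalityI[OF wreath_power_extensional[OF Suc.prems]])
      fix zs assume zs: "zs \<in> nlists (Suc n) X"
      then show "f zs = restrict (tree_map ?p) (nlists (Suc n) X) zs"
      proof (rule nlists_Suc_snocE)
        fix xs x assume xs: "zs = xs @ [x]" "xs \<in> nlists n X" "x \<in> X"
        have "tree_map ?p xs = tree_map q xs"
          by (rule tree_map_cong) (use xs(2) in \<open>auto simp: nlists_def\<close>)
        then show ?thesis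
          using xs zs c[OF xs(2)] by (simp add: f q(2) perm_def)
      qed
    qed simp
    ultimately show ?case by blast
  qed
  then show ?thesis using that by blast
qed

lemma topologically_finitely_generated_iff:
  "topologically_finitely_generated W_inf (infinite_wreath_power_topology (\<phi> ` carrier H) X) \<longleftrightarrow>
    (\<exists>S. finite S \<and> S \<subseteq> carrier W_inf \<and>
      (\<forall>s\<in>carrier W_inf. \<forall>n. \<exists>t\<in>generate W_inf S. t n = s n))"
proof -
  have "Abstract_Topology.closure_of (infinite_wreath_power_topology (\<phi> ` carrier H) X) (generate W_inf S) =
      topspace (infinite_wreath_power_topology (\<phi> ` carrier H) X) \<longleftrightarrow>
    (\<forall>s\<in>carrier W_inf. \<forall>n. \<exists>t\<in>generate W_inf S. t n = s n)"
    if "S \<subseteq> carrier W_inf" for S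
    using group.generate_incl[OF group_W_inf that]
    unfolding infinite_wreath_power_topology_def infinite_wreath_power_def
    by (rule inverse_limit_closure_of_eq_topspace_iff)
  then show ?thesis
    unfolding topologically_finitely_generated_def by (intro ex_cong1 conj_cong refl)
qed

lemma truncations_id: "truncations X id = \<one>\<^bsub>W_inf\<^esub>"
  by (auto simp: truncations_def infinite_wreath_power_def inverse_limit_def perm_group_def
      BijGroup_def fun_eq_iff restrict_def)

lemma truncations_inv:
  assumes p: "range p \<subseteq> perms"
  obtains q where "range q \<subseteq> perms" "inv_into UNIV (tree_map p) = tree_map q"
    "truncations X (tree_map q) = inv\<^bsub>W_inf\<^esub> truncations X (tree_map p)"
proof -
  let ?q = "\<lambda>xs. inv_into UNIV (p (inv_into UNIV (tree_map p) xs))"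
  have q: "range ?q \<subseteq> perms" using p perms_inv by blast
  have bij: "bij (p xs)" for xs using p perms_bij by blast
  have inv: "inv_into UNIV (tree_map p) = tree_map ?q" by (rule inv_tree_map[OF bij])
  have "tree_map ?q \<circ> tree_map p = id"
    unfolding inv[symmetric] using bij_tree_map[of p, OF bij] by (simp add: bij_is_inj)
  then have "truncations X (tree_map ?q) \<otimes>\<^bsub>W_inf\<^esub> truncations X (tree_map p) = \<one>\<^bsub>W_inf\<^esub>"
    using truncations_comp[OF q p] truncations_id by metis
  then have "truncations X (tree_map ?q) = inv\<^bsub>W_inf\<^esub> truncations X (tree_map p)"
    using group.inv_equality[OF group_W_inf] truncations_in_W_inf p q by metis
  with q inv show ?thesis using that by blast
qed

text \<open>The pullback of the generated subgroup along truncation. Labels are taken in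
  \<open>perms\<close>, where truncation respects products and inverses.\<close>

lemma tree_map_group_generate:
  assumes S: "S \<subseteq> carrier W_inf"
  shows "tree_map_group H X \<phi> {tree_map p |p. range p \<subseteq> perms \<and> truncations X (tree_map p) \<in> generate W_inf S}"
proof (unfold_locales, goal_cases)
  case 1
  have "tree_map (\<lambda>_. id) = (id :: 'a list \<Rightarrow> 'a list)" by (rule tree_map_id)
  moreover have "range (\<lambda>_. id) \<subseteq> perms" using perms_id by blast
  moreover have "truncations X (tree_map (\<lambda>_. id)) \<in> generate W_inf S"
    unfolding tree_map_id truncations_id by (rule generate.one)
  ultimately show ?case by (metis (mono_tags, lifting) mem_Collect_eq)
next
  case (2 f g)
  then obtain p q where p: "f = tree_map p" "range p \<subseteq> perms" "truncations X (tree_map p) \<in> generate W_inf S"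
    and q: "g = tree_map q" "range q \<subseteq> perms" "truncations X (tree_map q) \<in> generate W_inf S" by blast
  let ?r = "\<lambda>xs. p (tree_map q xs) \<circ> q xs"
  have "f \<circ> g = tree_map ?r" unfolding p(1) q(1) by (rule tree_map_comp)
  moreover have "range ?r \<subseteq> perms"
  proof
    fix k assume "k \<in> range ?r"
    then obtain xs where "k = p (tree_map q xs) \<circ> q xs" by blast
    moreover have "p (tree_map q xs) \<in> perms" "q xs \<in> perms" using p(2) q(2) by blast+
    ultimately show "k \<in> perms" by (simp only: perms_comp)
  qed
  moreover have "truncations X (tree_map ?r) \<in> generate W_inf S"
    unfolding tree_map_comp[symmetric] truncations_comp[OF p(2) q(2)]
    by (rule generate.eng[OF p(3) q(3)])
  ultimately show ?case by blast
next
  case (3 f)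
  then obtain p where p: "f = tree_map p" "range p \<subseteq> perms" "truncations X (tree_map p) \<in> generate W_inf S"
    by blast
  obtain q where q: "range q \<subseteq> perms" "inv_into UNIV (tree_map p) = tree_map q"
    "truncations X (tree_map q) = inv\<^bsub>W_inf\<^esub> truncations X (tree_map p)"
    by (rule truncations_inv[OF p(2)])
  have "truncations X (tree_map q) \<in> generate W_inf S"
    unfolding q(3) by (rule group.generate_m_inv_closed[OF group_W_inf S p(3)])
  then show ?case using q(1,2) p(1) by blast
qed

lemma range_single: "k \<in> perms \<Longrightarrow> range (single v k) \<subseteq> perms"
  using perms_id by (auto simp: single_def)

lemma range_spine: "k \<in> perms \<Longrightarrow> range (spine a b m k) \<subseteq> perms"
  using perms_id by (auto simp: spine_def)

lemma topologically_finitely_generated_if_perfect: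
  assumes perfect: "perfect_group H"
  shows "topologically_finitely_generated W_inf (infinite_wreath_power_topology (\<phi> ` carrier H) X)"
proof -
  obtain a where a: "a \<in> X" using points_nonempty by blast
  show ?thesis
  proof (cases "X = {a}")
    \<comment> \<open>A one-point set offers no second letter \<open>b\<close>. Every level then has
      one word and every stage one permutation, so the empty set of generators will do.\<close>
    case True
    have "\<one>\<^bsub>W_inf\<^esub> n = s n" if s: "s \<in> carrier W_inf" for s n
    proof -
      have "Bij (nlists n X) \<subseteq> {replicate n a} \<rightarrow>\<^sub>E {replicate n a}"
        using Bij_subset_PiE[of "nlists n X"] by (simp only: True nlists_singleton)
      then have bij: "W n \<subseteq> {replicate n a} \<rightarrow>\<^sub>E {replicate n a}" using W_bij by blast
      have "\<one>\<^bsub>W_inf\<^esub> \<in> carrier W_inf" using group.is_monoid[OF group_W_inf] monoid.one_closed by blast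
      then have "\<one>\<^bsub>W_inf\<^esub> n \<in> {replicate n a} \<rightarrow>\<^sub>E {replicate n a}" "s n \<in> {replicate n a} \<rightarrow>\<^sub>E {replicate n a}"
        using s bij unfolding W_inf_carrier_iff by blast+
      then show ?thesis by auto
    qed
    then show ?thesis
      unfolding topologically_finitely_generated_iff
      by (intro exI[of _ "{}"]) (auto intro: generate.one)
  next
    case False
    then obtain b where b: "b \<in> X" "a \<noteq> b" using a by blast
    define S where "S = truncations X ` (\<Union>k\<in>perms. {tree_map (single [] k), tree_map (single [a] k),
      tree_map (spine a b 0 k), tree_map (spine a b 1 k)})"
    have S: "S \<subseteq> carrier W_inf"
      unfolding S_def by (auto intro!: truncations_in_W_inf range_single range_spine)
    define T where "T = {tree_map p |p. range p \<subseteq> perms \<and> truncations X (tree_map p) \<in> generate W_inf S}"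
    have T_I: "tree_map p \<in> T" if "range p \<subseteq> perms" "truncations X (tree_map p) \<in> S" for p
      unfolding T_def using that generate.incl by fastforce
    have T_D: "truncations X f \<in> generate W_inf S" if "f \<in> T" for f
      using that unfolding T_def by blast
    interpret tree_map_group H X \<phi> T
      unfolding T_def by (rule tree_map_group_generate[OF S])
    have gens: "{tree_map (single [] k), tree_map (single [a] k), tree_map (spine a b 0 k), tree_map (spine a b 1 k)} \<subseteq> T"
      if k: "k \<in> perms" for k
      unfolding insert_subset using k range_single[OF k] range_spine[OF k]
      by (intro conjI T_I empty_subsetI) (auto simp: S_def)
    have "\<exists>t\<in>generate W_inf S. t n = s n" if s: "s \<in> carrier W_inf" for s n
    proof -
      have "s n \<in> W n" using s unfolding W_inf_carrier_iff by blast
      then obtain p where p: "p \<in> portraits n" "s n = restrict (tree_map p) (nlists n X)"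
        by (rule W_portraitE)
      have "tree_map p \<in> T"
        using finitary_portraits_generated[OF perfect a b gens] p(1) by blast
      then have "truncations X (tree_map p) \<in> generate W_inf S" by (rule T_D)
      moreover have "truncations X (tree_map p) n = s n" by (simp add: p(2) truncations_def)
      ultimately show ?thesis by blast
    qed
    moreover have "finite S" unfolding S_def by (intro finite_imageI finite_UN_I finite_perms) simp
    ultimately show ?thesis 
      unfolding topologically_finitely_generated_iff using S by (intro exI[of _ S] conjI ballI allI)
  qed
qed

end

section \<open>The characters of the levels\<close>

context finite_transitive_action
begin

text \<open>The local action of \<open>f\<close> at \<open>xs\<close>, read as an element of the
  abstract group; faithfulness makes the preimage under \<open>\<phi>\<close> unique. It is
  meaningful for \<open>f\<close> in \<open>W (Suc n)\<close> and words \<open>xs\<close> over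
  \<open>X\<close> of length \<open>n\<close>.\<close>

definition label :: "('a list \<Rightarrow> 'a list) \<Rightarrow> 'a list \<Rightarrow> _" where
  "label f xs = inv_into (carrier H) \<phi> (\<lambda>x\<in>X. last (f (xs @ [x])))"

lemma label_eqI:
  assumes "h \<in> carrier H" "\<And>x. x \<in> X \<Longrightarrow> f (xs @ [x]) = ys @ [\<phi> h x]"
  shows "label f xs = h"
proof -
  have "(\<lambda>x\<in>X. last (f (xs @ [x]))) = \<phi> h"
    using assms bij_prop0[THEN Bij_imp_extensional]
    by (intro extensionalityI[where A = X]) auto
  then show ?thesis using inv_into_f_f[OF faithful assms(1)] by (simp add: label_def)
qed

lemma W_label:
  assumes "f \<in> W (Suc n)" "xs \<in> nlists n X"
  shows "label f xs \<in> carrier H"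
    and "x \<in> X \<Longrightarrow> f (xs @ [x]) = wreath_proj X n f xs @ [\<phi> (label f xs) x]"
proof -
  obtain g h where g: "g \<in> W n" and h: "h \<in> nlists n X \<rightarrow> \<phi> ` carrier H"
    and f: "\<And>xs x. xs \<in> nlists n X \<Longrightarrow> x \<in> X \<Longrightarrow> f (xs @ [x]) = g xs @ [h xs x]"
    using assms(1) by (elim wreath_power_SucE) blast
  obtain c where c: "c \<in> carrier H" "h xs = \<phi> c" using h assms(2) by blast
  have "label f xs = c" using c f assms(2) by (intro label_eqI[where ys = "g xs"]) auto
  moreover have "wreath_proj X n f = g" using wreath_proj_eq[OF points_nonempty g f] .
  ultimately show "label f xs \<in> carrier H"
    "x \<in> X \<Longrightarrow> f (xs @ [x]) = wreath_proj X n f xs @ [\<phi> (label f xs) x]"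
    using c f assms(2) by auto
qed

text \<open>The cocycle rule inside the wreath powers: when \<open>f\<close> acts, \<open>g\<close>
  has already moved the prefix as its projection prescribes.\<close>

lemma label_compose:
  assumes f: "f \<in> W (Suc n)" and g: "g \<in> W (Suc n)" and xs: "xs \<in> nlists n X"
  shows "label (compose (nlists (Suc n) X) f g) xs = label f (wreath_proj X n g xs) \<otimes> label g xs"
proof (rule label_eqI)
  let ?ys = "wreath_proj X n g xs"
  have ys: "?ys \<in> nlists n X"
    using W_bij[OF wreath_proj_closed[OF points_nonempty g]] xs Bij_imp_funcset by blast
  note labels = W_label(1)[OF f ys] W_label(1)[OF g xs]
  show "label f ?ys \<otimes> label g xs \<in> carrier H" using labels by simp
  fix x assume x: "x \<in> X"
  have "compose (nlists (Suc n) X) f g (xs @ [x]) = f (g (xs @ [x]))"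
    using x xs by (simp add: compose_eq nlists_snoc_iff)
  also have "g (xs @ [x]) = ?ys @ [\<phi> (label g xs) x]" by (rule W_label(2)[OF g xs x])
  also have "f \<dots> = wreath_proj X n f ?ys @ [\<phi> (label f ?ys) (\<phi> (label g xs) x)]"
    by (rule W_label(2)[OF f ys action_closed[OF labels(2) x]])
  also have "\<phi> (label f ?ys) (\<phi> (label g xs) x) = \<phi> (label f ?ys \<otimes> label g xs) x"
    using action_mult[OF labels] x by (simp add: compose_eq del: act.hom_mult)
  finally show "compose (nlists (Suc n) X) f g (xs @ [x]) =
      wreath_proj X n f ?ys @ [\<phi> (label f ?ys \<otimes> label g xs) x]" .
qed

abbreviation commutator_subgroup where
  "commutator_subgroup \<equiv> derived H (carrier H)"

abbreviation abelianization where
  "abelianization \<equiv> H Mod commutator_subgroup"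

text \<open>Labels at words of length \<open>n\<close> act on the letter that follows, so
  \<open>f\<close> is taken from stage \<open>Suc n\<close>. The vertices need no order because the
  quotient is abelian.\<close>

definition level_char :: "nat \<Rightarrow> ('a list \<Rightarrow> 'a list) \<Rightarrow> _" where
  "level_char n f = finprod abelianization (\<lambda>xs. commutator_subgroup #> label f xs) (nlists n X)"

lemma comm_group_abelianization: "comm_group abelianization"
  by (rule act.G.derived_quot_is_comm_group)

lemma coset_hom: "(\<lambda>h. commutator_subgroup #> h) \<in> hom H abelianization"
  by (rule normal.r_coset_hom_Mod[OF act.G.derived_self_is_normal])

lemma coset_closed: "h \<in> carrier H \<Longrightarrow> commutator_subgroup #> h \<in> carrier abelianization"
  using hom_in_carrier[OF coset_hom] .

lemma level_char_closed:
  assumes "f \<in> W (Suc n)"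
  shows "level_char n f \<in> carrier abelianization"
proof -
  interpret A: comm_group abelianization by (rule comm_group_abelianization)
  show ?thesis
    unfolding level_char_def using W_label(1)[OF assms] coset_closed by (intro A.finprod_closed) blast
qed

text \<open>The labels of \<open>f\<close> are taken at the images of the vertices under
  \<open>g\<close>. These images run through the level exactly once, so reindexing the product
  removes the shift.\<close>

lemma level_char_compose:
  assumes f: "f \<in> W (Suc n)" and g: "g \<in> W (Suc n)"
  shows "level_char n (compose (nlists (Suc n) X) f g) =
    level_char n f \<otimes>\<^bsub>abelianization\<^esub> level_char n g"
proof -
  interpret A: comm_group abelianization by (rule comm_group_abelianization)
  let ?\<pi> = "wreath_proj X n g" and ?X = "nlists n X"
  let ?c = "\<lambda>f xs. commutator_subgroup #> label f xs"
  have \<pi>: "bij_betw ?\<pi> ?X ?X"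
    using W_bij[OF wreath_proj_closed[OF points_nonempty g]] by (simp add: Bij_def)
  have c: "?c f \<in> ?X \<rightarrow> carrier abelianization" "?c g \<in> ?X \<rightarrow> carrier abelianization"
    using W_label(1)[OF f] W_label(1)[OF g] coset_closed by blast+
  have c\<pi>: "(\<lambda>xs. ?c f (?\<pi> xs)) \<in> ?X \<rightarrow> carrier abelianization"
    using c(1) bij_betwE[OF \<pi>] by blast
  have "level_char n (compose (nlists (Suc n) X) f g) =
      finprod abelianization (\<lambda>xs. ?c f (?\<pi> xs) \<otimes>\<^bsub>abelianization\<^esub> ?c g xs) ?X"
    unfolding level_char_def
  proof (rule A.finprod_cong')
    fix xs assume xs: "xs \<in> ?X"
    then have "?\<pi> xs \<in> ?X" using bij_betwE[OF \<pi>] by blast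
    then show "?c (compose (nlists (Suc n) X) f g) xs = ?c f (?\<pi> xs) \<otimes>\<^bsub>abelianization\<^esub> ?c g xs"
      unfolding label_compose[OF f g xs]
      using hom_mult[OF coset_hom] W_label(1)[OF f] W_label(1)[OF g xs] by blast
  qed (use c(2) c\<pi> in \<open>auto intro!: A.m_closed simp del: mult_FactGroup\<close>)
  also have "\<dots> = finprod abelianization (\<lambda>xs. ?c f (?\<pi> xs)) ?X \<otimes>\<^bsub>abelianization\<^esub> level_char n g"
    unfolding level_char_def using c(2) c\<pi> by (rule A.finprod_multf[rotated])
  also have "finprod abelianization (\<lambda>xs. ?c f (?\<pi> xs)) ?X = finprod abelianization (?c f) (?\<pi> ` ?X)"
    using \<pi> c(1) by (intro A.finprod_reindex[symmetric]) (auto simp: bij_betw_def)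
  also have "\<dots> = level_char n f"
    unfolding level_char_def using \<pi> by (simp add: bij_betw_def)
  finally show ?thesis .
qed

lemma level_char_hom: "(\<lambda>s. level_char n (s (Suc n))) \<in> hom W_inf abelianization"
proof (rule homI)
  fix s t assume st: "s \<in> carrier W_inf" "t \<in> carrier W_inf"
  then have "s (Suc n) \<in> W (Suc n)" "t (Suc n) \<in> W (Suc n)" unfolding W_inf_carrier_iff by blast+
  then show "level_char n ((s \<otimes>\<^bsub>W_inf\<^esub> t) (Suc n)) =
      level_char n (s (Suc n)) \<otimes>\<^bsub>abelianization\<^esub> level_char n (t (Suc n))"
    unfolding W_inf_mult[OF st] by (rule level_char_compose)
next
  fix s assume "s \<in> carrier W_inf"
  then show "level_char n (s (Suc n)) \<in> carrier abelianization"
    unfolding W_inf_carrier_iff by (blast intro: level_char_closed)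
qed

text \<open>Such elements tell the characters apart: the only factor that can be nontrivial sits on
  level \<open>j\<close>.\<close>

lemma level_char_single:
  assumes h: "h \<in> carrier H" and v: "v \<in> nlists j X"
  shows "level_char n (truncations X (tree_map (single v (perm h))) (Suc n)) =
    (if n = j then commutator_subgroup #> h else \<one>\<^bsub>abelianization\<^esub>)"
proof -
  interpret A: comm_group abelianization by (rule comm_group_abelianization)
  let ?f = "truncations X (tree_map (single v (perm h))) (Suc n)"
  let ?d = "\<lambda>xs. if xs = v then h else \<one>"
  have label: "label ?f xs = ?d xs" if xs: "xs \<in> nlists n X" for xs
  proof (rule label_eqI)
    show "?d xs \<in> carrier H" using h by simp
    fix x assume x: "x \<in> X"
    have "single v (perm h) xs x = \<phi> (?d xs) x"
      using x id_eq_one by (auto simp: perm_def single_def simp del: act.hom_one simp flip: id_eq_one)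
    then show "?f (xs @ [x]) = truncations X (tree_map (single v (perm h))) n xs @ [\<phi> (?d xs) x]"
      using restrict_tree_map_snoc[OF range_single[OF perm_in_perms[OF h]] xs x] x by simp
  qed
  have one: "commutator_subgroup #> \<one> = \<one>\<^bsub>abelianization\<^esub>"
    using hom_one[OF coset_hom act.G.is_group A.is_group] .
  note fin = finite_nlists[OF finite_points, of n]
  have "level_char n ?f =
      finprod abelianization (\<lambda>xs. if v = xs then commutator_subgroup #> h else \<one>\<^bsub>abelianization\<^esub>) (nlists n X)"
    unfolding level_char_def
    by (rule A.finprod_cong') (use coset_closed[OF h] one in \<open>auto simp: label simp del: one_FactGroup\<close>)
  also have "\<dots> = (if n = j then commutator_subgroup #> h else \<one>\<^bsub>abelianization\<^esub>)"
  proof (cases "n = j")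
    case True
    then show ?thesis
      using A.finprod_singleton[of v "nlists n X" "\<lambda>_. commutator_subgroup #> h"] v fin coset_closed[OF h] by simp
  next
    case False
    then have "v \<notin> nlists n X" using v by (auto simp: nlists_def)
    then have "finprod abelianization
        (\<lambda>xs. if v = xs then commutator_subgroup #> h else \<one>\<^bsub>abelianization\<^esub>) (nlists n X) = \<one>\<^bsub>abelianization\<^esub>"
      by (intro A.finprod_one_eqI) auto
    then show ?thesis using False by (simp only: if_False)
  qed
  finally show ?thesis .
qed

section \<open>Pigeonhole on the characters of the levels\<close>

lemma finite_carrier: "finite (carrier H)"
proof -
  have "\<phi> ` carrier H \<subseteq> X \<rightarrow>\<^sub>E X"
    using bij_prop0 Bij_subset_PiE[of X] by blast
  moreover have "finite (X \<rightarrow>\<^sub>E X)" by (intro finite_PiE finite_points)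
  ultimately show ?thesis by (rule finite_imageD[OF finite_subset faithful])
qed

lemma perfect_if_topologically_finitely_generated:
  assumes "topologically_finitely_generated W_inf (infinite_wreath_power_topology (\<phi> ` carrier H) X)"
  shows "perfect_group H"
proof (rule ccontr)
  assume "\<not> perfect_group H"
  then have "commutator_subgroup \<noteq> carrier H"
    using act.G.is_group unfolding perfect_group_def by blast
  moreover have "commutator_subgroup \<subseteq> carrier H" by (rule act.G.derived_in_carrier) simp
  ultimately obtain c where c: "c \<in> carrier H" "c \<notin> commutator_subgroup" by blast
  obtain S where S: "finite S" "S \<subseteq> carrier W_inf"
    and dense: "\<And>s n. s \<in> carrier W_inf \<Longrightarrow> \<exists>t\<in>generate W_inf S. t n = s n"
    using assms unfolding topologically_finitely_generated_iff by blast
  let ?\<chi> = "\<lambda>n s. level_char n (s (Suc n))"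
  have \<chi>: "group_hom W_inf abelianization (?\<chi> n)" for n
    using level_char_hom group_W_inf comm_group_abelianization
    by (simp add: group_hom_def group_hom_axioms_def comm_group.axioms)
  have "finite (carrier abelianization)"
    using finite_carrier by (simp add: carrier_FactGroup)
  then have "finite (S \<rightarrow>\<^sub>E carrier abelianization)" using S(1) by (intro finite_PiE) auto
  moreover have "range (\<lambda>n. restrict (?\<chi> n) S) \<subseteq> S \<rightarrow>\<^sub>E carrier abelianization"
    using S(2) level_char_hom by (auto simp: hom_def Pi_iff)
  ultimately have "finite (range (\<lambda>n. restrict (?\<chi> n) S))" by (rule rev_finite_subset)
  \<comment> \<open>There are infinitely many levels but only finitely many maps from
    \<open>S\<close> to the finite quotient, so two characters agree on \<open>S\<close>.\<close>
  then have "\<not> inj (\<lambda>n. restrict (?\<chi> n) S)" 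
    using finite_imageD[of "\<lambda>n. restrict (?\<chi> n) S" UNIV] by auto
  then obtain j k where jk: "j \<noteq> k" "restrict (?\<chi> j) S = restrict (?\<chi> k) S" by (auto simp: inj_def)
  have gens: "?\<chi> j t = ?\<chi> k t" if "t \<in> S" for t
    using fun_cong[OF jk(2), of t] that by simp
  have agree: "?\<chi> j t = ?\<chi> k t" if t: "t \<in> generate W_inf S" for t
    using t
  proof induction
    case one
    show ?case using group_hom.hom_one[OF \<chi>, of j] group_hom.hom_one[OF \<chi>, of k] by simp
  next
    case (incl h)
    then show ?case by (rule gens)
  next
    case (inv h)
    then have "h \<in> carrier W_inf" using S(2) by blast
    then show ?case
      using gens[OF inv] group_hom.hom_inv[OF \<chi>, of h j] group_hom.hom_inv[OF \<chi>, of h k] by simp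
  next
    case (eng s t)
    then have "s \<in> carrier W_inf" "t \<in> carrier W_inf"
      using group.generate_in_carrier[OF group_W_inf S(2)] by blast+
    then show ?case
      using eng hom_mult[OF level_char_hom, of s t j] hom_mult[OF level_char_hom, of s t k] by simp
  qed
  obtain a where a: "a \<in> X" using points_nonempty by blast
  \<comment> \<open>With the single label \<open>c\<close> on level \<open>j\<close>, the character
    of level \<open>j\<close> gives a nontrivial coset and that of level \<open>k\<close> the
    identity.\<close>
  let ?v = "replicate j a"
  let ?s = "truncations X (tree_map (single ?v (perm c)))"
  have v: "?v \<in> nlists j X" using a by (auto simp: nlists_def)
  have s: "?s \<in> carrier W_inf"
    by (intro truncations_in_W_inf range_single perm_in_perms c(1))
  obtain t where t: "t \<in> generate W_inf S" "t (Suc (max j k)) = ?s (Suc (max j k))"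
    using dense[OF s] by blast
  \<comment> \<open>The two characters read the coordinates \<open>Suc j\<close> and
    \<open>Suc k\<close>; agreement at the larger index forces agreement at both.\<close>
  have "t (Suc i) = ?s (Suc i)" if "i \<le> max j k" for i
    using inverse_limit_eq_below[of t _ _ ?s "Suc (max j k)" "Suc i"] that t(2) s
      group.generate_in_carrier[OF group_W_inf S(2) t(1)]
    unfolding infinite_wreath_power_def by simp
  then have "?\<chi> j ?s = ?\<chi> k ?s"
    using agree[OF t(1)] by simp
  then have "commutator_subgroup #> c = commutator_subgroup"
    using jk(1) by (simp add: level_char_single[OF c(1) v])
  moreover have "c \<in> commutator_subgroup #> c"
    using act.G.rcos_self[OF c(1) act.G.derived_is_subgroup] by simp
  ultimately show False using c(2) by simp
qed

end

text \<open>The permutation group is the image of an abstract group under \<open>\<phi>\<close>.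
  Faithfulness identifies the two, so perfectness can be asked of \<open>H\<close> itself.\<close>

theorem corollary3:
  fixes H :: "('g, 'm) monoid_scheme" and X :: "'a set" and \<phi> :: "'g \<Rightarrow> 'a \<Rightarrow> 'a"
  assumes "finite X" and "X \<noteq> {}"
    and "faithful_action H X \<phi>" and "transitive_action H X \<phi>"
  shows "topologically_finitely_generated
      (infinite_wreath_power (\<phi> ` carrier H) X)
      (infinite_wreath_power_topology (\<phi> ` carrier H) X)
    \<longleftrightarrow> perfect_group H"
proof -
  interpret finite_transitive_action H X \<phi>
    using assms by (simp add: finite_transitive_action_def finite_transitive_action_axioms_def)
  show ?thesis
    by (rule iffI[OF perfect_if_topologically_finitely_generated topologically_finitely_generated_if_perfect])
qed

end
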